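(* Let $N\ge 1$, let $\Omega\subset\mathbb{R}^N$ be a non-empty, open, bounded domain with Lipschitz boundary, let $\mathcal{C}:=\Omega\times(0,\infty)$, and let $s:\Omega\to\mathbb{R}$ be measurable with $s(x)\in[0,1]$ for almost all $x\in\Omega$. Put $\delta(x):=1-2s(x)$. Suppose that the zero set $\{x\in\Omega: s(x)=0\}$ has Lebesgue measure zero. Let $X$ denote either of the spaces $H=H(\mathcal{C};y^{\delta(x)})$ or $H_0=H_0(\mathcal{C};y^{\delta(x)})$. Then there exists a unique bounded linear operator $$\mathrm{tr}_\Omega: X\to L^2(\Omega;(1-\delta(x))^2)=L^2(\Omega;s(x)^2)$$ such that $\mathrm{tr}_\Omega(u)=u|_{\Omega\times\{0\}}$ for all $u\in H\cap C^\infty(\overline{\mathcal{C}})$ in the case $X=H$, and for all $u\in H_0\cap C_c^\infty(\mathcal{C}_\Omega)$ in the case $X=H_0$.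
   Context: Points of $\mathcal{C}$ are written $(x,y)$ with $x\in\Omega$, $y>0$, and $\mathcal{C}_\Omega:=(\Omega\times\{0\})\cup\mathcal{C}$. For a function $u$ on $\mathcal{C}$ define $$\|u\|_H:=\left(\int_{\mathcal{C}}y^{\delta(x)}\left(|u|^2+|\nabla u|^2\right)dx\,dy\right)^{1/2}\in[0,+\infty].$$ $H(\mathcal{C};y^{\delta(x)})$ is the closure of $\{v\in C^\infty(\overline{\mathcal{C}}):\|v\|_H<+\infty\}$ with respect to $\|\cdot\|_H$, and $H_0(\mathcal{C};y^{\delta(x)})$ is the closure of $\{v\in C_c^\infty(\mathcal{C}_\Omega):\|v\|_H<+\infty\}$ with respect to $\|\cdot\|_H$. Here $C^\infty(\overline{\mathcal{C}})$ denotes functions smooth up to the boundary of $\mathcal{C}$, and $C_c^\infty(\mathcal{C}_\Omega)$ denotes such functions with compact support contained in $\mathcal{C}_\Omega$. Both closures may be taken inside the weighted Sobolev space $W(\mathcal{C};y^{\delta(x)})$ of functions $u\in L^1_{\mathrm{loc}}(\mathcal{C})$ with $\int_{\mathcal{C}} y^{\delta(x)}|u|^2\,dx\,dy<\infty$ whose distributional gradient satisfies $|\nabla u|\in L^1_{\mathrm{loc}}(\mathcal{C})$ and $\int_{\mathcal{C}} y^{\delta(x)}|\nabla u|^2\,dx\,dy<\infty$, endowed with the norm $\|\cdot\|_H$. For a non-negative measurable weight $\rho$ on $\Omega$, $L^2(\Omega;\rho)$ is the space of (classes of) measurable functions $g$ on $\Omega$ with norm $\left(\int_\Omega|g|^2\rho\,dx\right)^{1/2}<\infty$;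 since $(1-\delta(x))^2=4s(x)^2$, the two target spaces coincide with equivalent norms. *)

theory Defs
  imports "HOL-Analysis.Analysis"
begin

text \<open>
  Euclidean space of arbitrary dimension is any type of class \<open>euclidean_space\<close>.
  Elements of the function spaces below are represented by functions, only the values on
  the indicated domain being relevant; classes modulo almost everywhere equality are
  rendered by explicit statements about almost all points.
\<close>

section \<open>Lipschitz domains\<close>

text \<open>
  Near each boundary point, the set is the strict epigraph, in some unit direction \<open>e\<close>,
  of a Lipschitz function \<open>\<gamma>\<close> on the hyperplane orthogonal to \<open>e\<close>.
  In dimension one the hyperplane is \<open>{0}\<close> and \<open>\<gamma>\<close> is a number.
\<close>

definition lipschitz_boundary :: "'a::euclidean_space set \<Rightarrow> bool" where
  "lipschitz_boundary \<Omega> \<longleftrightarrow>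
     (\<forall>p \<in> frontier \<Omega>. \<exists>e r L (\<gamma> :: 'a \<Rightarrow> real).
        norm e = 1 \<and> r > 0 \<and> L-lipschitz_on {w. w \<bullet> e = 0} \<gamma> \<and>
        \<Omega> \<inter> ball p r = {z \<in> ball p r. \<gamma> (z - (z \<bullet> e) *\<^sub>R e) < z \<bullet> e})"

section \<open>Smooth functions\<close>

text \<open>
  For an open set \<open>D\<close> and \<open>D \<subseteq> E \<subseteq> closure D\<close>: the function is of class \<open>C\<^sup>k\<close> in \<open>D\<close>, is
  continuous on \<open>E\<close>, and all its partial derivatives of order at most \<open>k\<close> extend
  continuously from \<open>D\<close> to \<open>E\<close>. The case \<open>E = D\<close> gives \<open>C\<^sup>k(D)\<close>, the case \<open>E = closure D\<close>
  gives the functions which are \<open>C\<^sup>k\<close> up to the boundary.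
\<close>

primrec Ck_up_to :: "'b::euclidean_space set \<Rightarrow> 'b set \<Rightarrow> nat \<Rightarrow> ('b \<Rightarrow> real) \<Rightarrow> bool" where
  "Ck_up_to D E 0 f \<longleftrightarrow> continuous_on E f"
| "Ck_up_to D E (Suc k) f \<longleftrightarrow>
     continuous_on E f \<and> (\<forall>z\<in>D. f differentiable (at z)) \<and>
     (\<forall>i\<in>Basis. \<exists>g. (\<forall>z\<in>D. g z = frechet_derivative f (at z) i) \<and> Ck_up_to D E k g)"

definition smooth_up_to :: "'b::euclidean_space set \<Rightarrow> 'b set \<Rightarrow> ('b \<Rightarrow> real) set" where
  "smooth_up_to D E = {f. \<forall>k. Ck_up_to D E k f}"

definition test_functions :: "'b::euclidean_space set \<Rightarrow> ('b \<Rightarrow> real) set" where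
  "test_functions D =
     {\<phi> \<in> smooth_up_to D D.
        compact (closure {z \<in> D. \<phi> z \<noteq> 0}) \<and> closure {z \<in> D. \<phi> z \<noteq> 0} \<subseteq> D}"

section \<open>Distributional gradient\<close>

definition locally_integrable_on ::
  "'b::euclidean_space set \<Rightarrow> ('b \<Rightarrow> 'c::euclidean_space) \<Rightarrow> bool" where
  "locally_integrable_on D f \<longleftrightarrow>
     (\<forall>K. compact K \<and> K \<subseteq> D \<longrightarrow> f absolutely_integrable_on K)"

definition has_weak_gradient ::
  "'b::euclidean_space set \<Rightarrow> ('b \<Rightarrow> real) \<Rightarrow> ('b \<Rightarrow> 'b) \<Rightarrow> bool" where
  "has_weak_gradient D u g \<longleftrightarrow>
     locally_integrable_on D u \<and> locally_integrable_on D g \<and>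
     (\<forall>\<phi> \<in> test_functions D. \<forall>i\<in>Basis.
        (LINT z:D|lebesgue. u z * frechet_derivative \<phi> (at z) i)
        = - (LINT z:D|lebesgue. (g z \<bullet> i) * \<phi> z))"

text \<open>Some representative; it is determined up to a null set when it exists.\<close>

definition weak_gradient ::
  "'b::euclidean_space set \<Rightarrow> ('b \<Rightarrow> real) \<Rightarrow> 'b \<Rightarrow> 'b" where
  "weak_gradient D u = (SOME g. has_weak_gradient D u g)"

section \<open>The cylinder and the weighted spaces\<close>

definition cylinder :: "'a::euclidean_space set \<Rightarrow> ('a \<times> real) set" where
  "cylinder \<Omega> = \<Omega> \<times> {0<..}"

definition cylinder_base :: "'a::euclidean_space set \<Rightarrow> ('a \<times> real) set" where
  "cylinder_base \<Omega> = (\<Omega> \<times> {0}) \<union> cylinder \<Omega>"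

text \<open>The square of the norm, with values in \<open>[0, \<infinity>]\<close>.\<close>

definition H_norm_sq ::
  "'a::euclidean_space set \<Rightarrow> ('a \<Rightarrow> real) \<Rightarrow> ('a \<times> real \<Rightarrow> real) \<Rightarrow> ennreal" where
  "H_norm_sq \<Omega> \<delta> u =
     (\<integral>\<^sup>+ z. ennreal (snd z powr \<delta> (fst z) *
        (\<bar>u z\<bar>\<^sup>2 + (norm (weak_gradient (cylinder \<Omega>) u z))\<^sup>2)) \<partial>lebesgue_on (cylinder \<Omega>))"

text \<open>Only meaningful where \<open>H_norm_sq\<close> is finite.\<close>

definition H_norm ::
  "'a::euclidean_space set \<Rightarrow> ('a \<Rightarrow> real) \<Rightarrow> ('a \<times> real \<Rightarrow> real) \<Rightarrow> real" where
  "H_norm \<Omega> \<delta> u = sqrt (enn2real (H_norm_sq \<Omega> \<delta> u))"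

definition W_space ::
  "'a::euclidean_space set \<Rightarrow> ('a \<Rightarrow> real) \<Rightarrow> ('a \<times> real \<Rightarrow> real) set" where
  "W_space \<Omega> \<delta> =
     {u. (\<exists>g. has_weak_gradient (cylinder \<Omega>) u g) \<and>
         (\<integral>\<^sup>+ z. ennreal (snd z powr \<delta> (fst z) * \<bar>u z\<bar>\<^sup>2) \<partial>lebesgue_on (cylinder \<Omega>)) < \<infinity> \<and>
         (\<integral>\<^sup>+ z. ennreal (snd z powr \<delta> (fst z) * (norm (weak_gradient (cylinder \<Omega>) u z))\<^sup>2)
            \<partial>lebesgue_on (cylinder \<Omega>)) < \<infinity>}"

definition smooth_cylinder :: "'a::euclidean_space set \<Rightarrow> ('a \<times> real \<Rightarrow> real) set" where
  "smooth_cylinder \<Omega> = smooth_up_to (cylinder \<Omega>) (closure (cylinder \<Omega>))"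

definition smooth_cylinder_c :: "'a::euclidean_space set \<Rightarrow> ('a \<times> real \<Rightarrow> real) set" where
  "smooth_cylinder_c \<Omega> =
     {v \<in> smooth_cylinder \<Omega>.
        compact (closure {z \<in> closure (cylinder \<Omega>). v z \<noteq> 0}) \<and>
        closure {z \<in> closure (cylinder \<Omega>). v z \<noteq> 0} \<subseteq> cylinder_base \<Omega>}"

definition H_closure ::
  "'a::euclidean_space set \<Rightarrow> ('a \<Rightarrow> real) \<Rightarrow> ('a \<times> real \<Rightarrow> real) set
    \<Rightarrow> ('a \<times> real \<Rightarrow> real) set" where
  "H_closure \<Omega> \<delta> S =
     {u \<in> W_space \<Omega> \<delta>. \<forall>\<epsilon>>0. \<exists>v\<in>S. H_norm_sq \<Omega> \<delta> v < \<infinity> \<and> H_norm \<Omega> \<delta> (\<lambda>z. u z - v z) < \<epsilon>}"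

definition H_space ::
  "'a::euclidean_space set \<Rightarrow> ('a \<Rightarrow> real) \<Rightarrow> ('a \<times> real \<Rightarrow> real) set" where
  "H_space \<Omega> \<delta> = H_closure \<Omega> \<delta> (smooth_cylinder \<Omega>)"

definition H0_space ::
  "'a::euclidean_space set \<Rightarrow> ('a \<Rightarrow> real) \<Rightarrow> ('a \<times> real \<Rightarrow> real) set" where
  "H0_space \<Omega> \<delta> = H_closure \<Omega> \<delta> (smooth_cylinder_c \<Omega>)"

definition L2w_norm_sq ::
  "'a::euclidean_space set \<Rightarrow> ('a \<Rightarrow> real) \<Rightarrow> ('a \<Rightarrow> real) \<Rightarrow> ennreal" where
  "L2w_norm_sq \<Omega> \<rho> g = (\<integral>\<^sup>+ x. ennreal (\<bar>g x\<bar>\<^sup>2 * \<rho> x) \<partial>lebesgue_on \<Omega>)"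

definition L2w_space ::
  "'a::euclidean_space set \<Rightarrow> ('a \<Rightarrow> real) \<Rightarrow> ('a \<Rightarrow> real) set" where
  "L2w_space \<Omega> \<rho> = {g \<in> borel_measurable (lebesgue_on \<Omega>). L2w_norm_sq \<Omega> \<rho> g < \<infinity>}"

definition L2w_norm ::
  "'a::euclidean_space set \<Rightarrow> ('a \<Rightarrow> real) \<Rightarrow> ('a \<Rightarrow> real) \<Rightarrow> real" where
  "L2w_norm \<Omega> \<rho> g = sqrt (enn2real (L2w_norm_sq \<Omega> \<rho> g))"

section \<open>Bounded linear operators between spaces of classes\<close>

text \<open>
  An operator from classes of functions on the measure space \<open>M\<close> to classes of functions on
  \<open>N\<close> is represented by a map on representatives: the second conjunct makes it well defined
  on classes, and linearity is an identity of classes.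
\<close>

definition bounded_linear_ae ::
  "'b measure \<Rightarrow> ('b \<Rightarrow> real) set \<Rightarrow> (('b \<Rightarrow> real) \<Rightarrow> real) \<Rightarrow>
   'c measure \<Rightarrow> ('c \<Rightarrow> real) set \<Rightarrow> (('c \<Rightarrow> real) \<Rightarrow> real) \<Rightarrow>
   (('b \<Rightarrow> real) \<Rightarrow> ('c \<Rightarrow> real)) \<Rightarrow> bool" where
  "bounded_linear_ae M X normX N Y normY T \<longleftrightarrow>
     (\<forall>u\<in>X. T u \<in> Y) \<and>
     (\<forall>u\<in>X. \<forall>v\<in>X. (AE z in M. u z = v z) \<longrightarrow> (AE x in N. T u x = T v x)) \<and>
     (\<forall>u\<in>X. \<forall>v\<in>X. AE x in N. T (\<lambda>z. u z + v z) x = T u x + T v x) \<and>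
     (\<forall>c. \<forall>u\<in>X. AE x in N. T (\<lambda>z. c * u z) x = c * T u x) \<and>
     (\<exists>K. \<forall>u\<in>X. normY (T u) \<le> K * normX u)"

text \<open>
  Bounded linear operators from a subspace \<open>X\<close> of the weighted Sobolev space to the
  weighted space of square integrable functions which restrict the elements of \<open>X \<inter> S\<close>,
  for a set \<open>S\<close> of functions continuous up to the boundary, to the base of the cylinder.
\<close>

definition trace_operator ::
  "'a::euclidean_space set \<Rightarrow> ('a \<Rightarrow> real) \<Rightarrow> ('a \<times> real \<Rightarrow> real) set \<Rightarrow>
   ('a \<times> real \<Rightarrow> real) set \<Rightarrow> ('a \<Rightarrow> real) \<Rightarrow>
   (('a \<times> real \<Rightarrow> real) \<Rightarrow> ('a \<Rightarrow> real)) \<Rightarrow> bool" where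
  "trace_operator \<Omega> \<delta> X S \<rho> T \<longleftrightarrow>
     bounded_linear_ae (lebesgue_on (cylinder \<Omega>)) X (H_norm \<Omega> \<delta>)
       (lebesgue_on \<Omega>) (L2w_space \<Omega> \<rho>) (L2w_norm \<Omega> \<rho>) T \<and>
     (\<forall>u \<in> X \<inter> S. AE x in lebesgue_on \<Omega>. T u x = u (x, 0))"

end

theory Submission
  imports Defs
begin

text \<open>
  On a vertical segment, the fundamental theorem of calculus and the Cauchy--Schwarz
  inequality with the weights \<open>y powr \<delta>\<close> and \<open>y powr (- \<delta>)\<close> give, since
  \<open>y powr (- \<delta>)\<close> has integral \<open>1 / (2 * s)\<close> over the unit interval,
  \<open>s\<^sup>2 * (v 0)\<^sup>2 \<le> 4 * \<integral> y powr \<delta> * (v\<^sup>2 + v'\<^sup>2)\<close>, with a constant independent of \<open>s\<close>.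
  Integrated over the base, this bounds the trace of a smooth function, whose weak and
  classical gradients agree. The trace of a general element is the almost everywhere limit
  of the traces of a fast approximating sequence, and since the weight is positive almost
  everywhere it is determined by the trace inequality.
\<close>

section \<open>Smooth functions and the fundamental lemma of the calculus of variations\<close>

text \<open>Before the weight enters, the trace constant is of size \<open>1 / s\<close>, and no
  positive lower bound on \<open>s\<close> is available; the factor \<open>s\<^sup>2\<close> turns
  \<open>1 / s\<close> into \<open>s\<close>, which is at most 1. This makes the estimate uniform
  over the base. Two obstacles shape the rest. \<open>H_norm\<close> refers to a chosen weak
  gradient, so no norm can be computed before weak gradients are known to be unique almost
  everywhere and to include the classical ones; the test functions and the integration by parts
  serve this purpose. Moreover \<open>H_norm\<close> sends an infinite square to 0, so estimates are
  made for squared norms with values in [0, infinity]. There (a + b)^2 \<le> 2 a^2 + 2 b^2 replaces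
  the triangle inequality and produces the powers of two in the constants. Existence and uniqueness
  of the operator are both read off from one relation, \<open>is_trace u g\<close>, which is linear
  and bounded and therefore single-valued almost everywhere.\<close>

lemma Ck_up_to_Suc_imp: "Ck_up_to D E (Suc k) f \<Longrightarrow> Ck_up_to D E k f"
proof (induction k arbitrary: f)
  case (Suc k)
  then show ?case by (subst Ck_up_to.simps(2)) (metis Ck_up_to.simps(2))
qed simp

lemma Ck_up_to_const: "Ck_up_to D E k (\<lambda>_. c)"
proof (induction k arbitrary: c)
  case (Suc k)
  then show ?case
    by (auto intro!: exI[of _ "\<lambda>_. 0"])
qed simp

lemma Ck_up_to_SucE:
  assumes "Ck_up_to D E (Suc k) f" "i \<in> Basis"
  obtains g where "\<forall>z\<in>D. g z = frechet_derivative f (at z) i" "Ck_up_to D E k g"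
proof -
  have "\<exists>g. (\<forall>z\<in>D. g z = frechet_derivative f (at z) i) \<and> Ck_up_to D E k g"
    using assms unfolding Ck_up_to.simps(2) by (elim conjE) (rule bspec)
  then show ?thesis by (elim exE conjE) (rule that)
qed

lemma Ck_up_to_has_derivative:
  "Ck_up_to D E (Suc k) f \<Longrightarrow> z \<in> D \<Longrightarrow> (f has_derivative frechet_derivative f (at z)) (at z)"
  by (simp add: frechet_derivative_works[symmetric])

lemma Ck_up_to_continuous_on: "Ck_up_to D E k f \<Longrightarrow> continuous_on E f"
  by (cases k) auto

text \<open>A derivative at \<open>z\<close> is unique, so an explicit formula \<open>f'\<close> may
  replace \<open>frechet_derivative\<close> in the recursion. The closure properties below are
  reduced to such formulas.\<close>

lemma Ck_up_to_SucI:
  assumes "continuous_on E f" "\<And>z. z \<in> D \<Longrightarrow> (f has_derivative f' z) (at z)"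
    and "\<And>i. i \<in> Basis \<Longrightarrow> \<exists>g. (\<forall>z\<in>D. g z = f' z i) \<and> Ck_up_to D E k g"
  shows "Ck_up_to D E (Suc k) f"
proof -
  have "frechet_derivative f (at z) = f' z" if "z \<in> D" for z
    using frechet_derivative_at[OF assms(2)[OF that]] by simp
  then show ?thesis
    using assms unfolding Ck_up_to.simps(2) differentiable_def by (metis (no_types, lifting))
qed

lemma Ck_up_to_add:
  "Ck_up_to D E k f \<Longrightarrow> Ck_up_to D E k g \<Longrightarrow> Ck_up_to D E k (\<lambda>z. f z + g z)"
proof (induction k arbitrary: f g)
  case (Suc k)
  show ?case
  proof (rule Ck_up_to_SucI)
    fix z assume "z \<in> D"
    then show "((\<lambda>z. f z + g z) has_derivative
        (\<lambda>h. frechet_derivative f (at z) h + frechet_derivative g (at z) h)) (at z)"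
      by (intro has_derivative_add Ck_up_to_has_derivative[OF Suc.prems(1)]
          Ck_up_to_has_derivative[OF Suc.prems(2)])
  next
    fix i :: 'a assume i: "i \<in> Basis"
    obtain f' where f': "\<And>z. z \<in> D \<Longrightarrow> f' z = frechet_derivative f (at z) i" "Ck_up_to D E k f'"
      using Ck_up_to_SucE[OF Suc.prems(1) i] by metis
    obtain g' where g': "\<And>z. z \<in> D \<Longrightarrow> g' z = frechet_derivative g (at z) i" "Ck_up_to D E k g'"
      using Ck_up_to_SucE[OF Suc.prems(2) i] by metis
    show "\<exists>h. (\<forall>z\<in>D. h z = frechet_derivative f (at z) i + frechet_derivative g (at z) i)
        \<and> Ck_up_to D E k h"
      using f' g' Suc.IH by (intro exI[of _ "\<lambda>z. f' z + g' z"]) simp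
  qed (intro continuous_intros Suc.prems[THEN Ck_up_to_continuous_on])
qed (auto intro!: continuous_intros)

text \<open>Induction along the Leibniz rule. Its terms contain undifferentiated factors, which are
  needed at level \<open>k\<close> although they are given at level \<open>Suc k\<close>;
  \<open>Ck_up_to_Suc_imp\<close> lowers the level.\<close>

lemma Ck_up_to_mult:
  "Ck_up_to D E k f \<Longrightarrow> Ck_up_to D E k g \<Longrightarrow> Ck_up_to D E k (\<lambda>z. f z * g z)"
proof (induction k arbitrary: f g)
  case (Suc k)
  show ?case
  proof (rule Ck_up_to_SucI)
    fix z assume "z \<in> D"
    then show "((\<lambda>z. f z * g z) has_derivative
        (\<lambda>h. f z * frechet_derivative g (at z) h + frechet_derivative f (at z) h * g z)) (at z)"
      by (intro has_derivative_mult Ck_up_to_has_derivative[OF Suc.prems(1)]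
          Ck_up_to_has_derivative[OF Suc.prems(2)])
  next
    fix i :: 'a assume i: "i \<in> Basis"
    obtain f' where f': "\<And>z. z \<in> D \<Longrightarrow> f' z = frechet_derivative f (at z) i" "Ck_up_to D E k f'"
      using Ck_up_to_SucE[OF Suc.prems(1) i] by metis
    obtain g' where g': "\<And>z. z \<in> D \<Longrightarrow> g' z = frechet_derivative g (at z) i" "Ck_up_to D E k g'"
      using Ck_up_to_SucE[OF Suc.prems(2) i] by metis
    show "\<exists>h. (\<forall>z\<in>D. h z
          = f z * frechet_derivative g (at z) i + frechet_derivative f (at z) i * g z)
        \<and> Ck_up_to D E k h"
      using f' g' Suc.IH Suc.prems[THEN Ck_up_to_Suc_imp]
      by (intro exI[of _ "\<lambda>z. f z * g' z + f' z * g z"]) (simp add: Ck_up_to_add)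
  qed (intro continuous_intros Suc.prems[THEN Ck_up_to_continuous_on])
qed (auto intro!: continuous_intros)

lemma Ck_up_to_diff:
  "Ck_up_to D E k f \<Longrightarrow> Ck_up_to D E k g \<Longrightarrow> Ck_up_to D E k (\<lambda>z. f z - g z)"
  using Ck_up_to_add[OF _ Ck_up_to_mult[OF Ck_up_to_const, of D E k g "-1"], of f] by simp

lemma Ck_up_to_power: "Ck_up_to D E k f \<Longrightarrow> Ck_up_to D E k (\<lambda>z. f z ^ n)"
  by (induction n) (auto intro: Ck_up_to_const Ck_up_to_mult)

lemma Ck_up_to_prod:
  assumes "finite I" "\<And>i. i \<in> I \<Longrightarrow> Ck_up_to D E k (f i)"
  shows "Ck_up_to D E k (\<lambda>z. \<Prod>i\<in>I. f i z)"
  using assms by (induction rule: finite_induct) (auto intro: Ck_up_to_const Ck_up_to_mult)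

text \<open>A family closed under differentiation lets the induction close up: the derivative of
  \<open>f (z \<bullet> b + c)\<close> along \<open>i\<close> is
  \<open>f' (z \<bullet> b + c)\<close> times the constant \<open>i \<bullet> b\<close>, again a
  function of this kind. Smoothness of all orders follows without a chain rule for general
  compositions.\<close>

lemma Ck_up_to_ridge:
  fixes F :: "(real \<Rightarrow> real) set" and b :: "'b::euclidean_space"
  assumes closed: "\<And>f. f \<in> F \<Longrightarrow> \<exists>f'\<in>F. \<forall>x. (f has_real_derivative f' x) (at x)"
    and "f \<in> F"
  shows "Ck_up_to D E k (\<lambda>z. f (z \<bullet> b + c))"
  using \<open>f \<in> F\<close>
proof (induction k arbitrary: f)
  case 0
  then obtain f' where "\<forall>x. (f has_real_derivative f' x) (at x)" using closed by blast
  then have "continuous_on UNIV f"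
    by (meson DERIV_isCont continuous_at_imp_continuous_on)
  then have "continuous_on E (\<lambda>z. f (z \<bullet> b + c))"
    by (rule continuous_on_compose2) (auto intro!: continuous_intros)
  then show ?case by simp
next
  case (Suc k)
  then obtain f' where f': "f' \<in> F" "\<And>x. (f has_real_derivative f' x) (at x)"
    using closed by blast
  have d: "((\<lambda>z. f (z \<bullet> b + c)) has_derivative (\<lambda>h. f' (z \<bullet> b + c) * (h \<bullet> b))) (at z)" for z
  proof -
    have "(f has_derivative (*) (f' (z \<bullet> b + c))) (at (z \<bullet> b + c))"
      using f'(2)[of "z \<bullet> b + c"] by (simp add: has_field_derivative_def)
    moreover have "((\<lambda>z. z \<bullet> b + c) has_derivative (\<lambda>h. h \<bullet> b)) (at z)"
      by (auto intro!: derivative_eq_intros)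
    ultimately show ?thesis
      using has_derivative_compose[of "\<lambda>z. z \<bullet> b + c" "\<lambda>h. h \<bullet> b" z UNIV f] by simp
  qed
  have "continuous_on E (\<lambda>z. f (z \<bullet> b + c))"
    using has_derivative_continuous[OF d] by (simp add: continuous_at_imp_continuous_on)
  then show ?case
    using Suc.IH[OF f'(1)] d
    by (intro Ck_up_to_SucI[where f' = "\<lambda>z h. f' (z \<bullet> b + c) * (h \<bullet> b)"])
       (auto intro!: Ck_up_to_mult Ck_up_to_const)
qed

section \<open>Smooth bump functions on boxes\<close>

definition flat_exp :: "real poly \<Rightarrow> real \<Rightarrow> real" where
  "flat_exp p x = (if x > 0 then poly p (1 / x) * exp (- (1 / x)) else 0)"

lemma tendsto_poly_div_exp: "((\<lambda>t. poly p t * exp (- t)) \<longlongrightarrow> (0::real)) at_top"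
proof -
  have "((\<lambda>t. \<Sum>i\<le>degree p. coeff p i * (t ^ i / exp t)) \<longlongrightarrow> (\<Sum>i\<le>degree p. coeff p i * 0)) at_top"
    by (intro tendsto_intros tendsto_power_div_exp_0)
  then show ?thesis
    by (simp add: poly_altdef exp_minus field_simps sum_distrib_left sum_divide_distrib)
qed

text \<open>With t = 1 / x one has dt/dx = - t^2, so the derivative of p(t) exp(- t) is t^2 (p(t) -
  p'(t)) exp(- t): differentiation acts on the polynomial alone. This is why arbitrary polynomial
  factors are carried along, although only \<open>p = 1\<close> is used for the bumps.\<close>

lemma flat_exp_has_derivative:
  "(flat_exp p has_real_derivative flat_exp (monom 1 2 * (p - pderiv p)) x) (at x)"
proof -
  consider "x > 0" | "x < 0" | "x = 0" by linarith
  then show ?thesis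
  proof cases
    case 1
    have "((\<lambda>x. poly p (1 / x) * exp (- (1 / x))) has_real_derivative
        flat_exp (monom 1 2 * (p - pderiv p)) x) (at x)"
      using 1
      by (auto intro!: derivative_eq_intros
          simp: flat_exp_def poly_monom field_simps power2_eq_square)
    then show ?thesis
      by (rule DERIV_cong_ev[THEN iffD1, rotated -1])
         (use 1 in \<open>auto simp: flat_exp_def eventually_nhds intro!: exI[of _ "{0<..}"]\<close>)
  next
    case 2
    have "((\<lambda>x. 0) has_real_derivative flat_exp (monom 1 2 * (p - pderiv p)) x) (at x)"
      using 2 by (simp add: flat_exp_def)
    then show ?thesis
      by (rule DERIV_cong_ev[THEN iffD1, rotated -1])
         (use 2 in \<open>auto simp: flat_exp_def eventually_nhds intro!: exI[of _ "{..<0}"]\<close>)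
  next
    case 3
    \<comment> \<open>For h > 0 the difference quotient \<open>flat_exp p h / h\<close> is t p(t)
      exp(- t) with t = 1 / h, and \<open>pCons 0 p\<close> is the polynomial t p(t).\<close>
    have "((\<lambda>t. poly (pCons 0 p) (inverse t) * exp (- (inverse t))) \<longlongrightarrow> 0) (at_right (0::real))"
      using tendsto_poly_div_exp filterlim_inverse_at_top_right by (rule filterlim_compose)
    then have "((\<lambda>h. flat_exp p h / h) \<longlongrightarrow> 0) (at_right 0)"
      by (rule Lim_transform_eventually)
         (auto simp: eventually_at_right_less flat_exp_def field_simps
            intro!: eventually_at_right_less[THEN eventually_mono])
    moreover have "((\<lambda>h. flat_exp p h / h) \<longlongrightarrow> 0) (at_left 0)"
      by (rule tendsto_eventually) (auto simp: flat_exp_def eventually_at_filter)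
    ultimately have "((\<lambda>h. flat_exp p h / h) \<longlongrightarrow> 0) (at 0)"
      by (simp add: filterlim_split_at)
    then show ?thesis
      using 3 by (simp add: DERIV_def flat_exp_def)
  qed
qed

lemma Ck_up_to_flat_exp: "Ck_up_to D E k (\<lambda>z. flat_exp p (z \<bullet> b + c))"
  by (rule Ck_up_to_ridge[where F = "range flat_exp"]) (auto intro: flat_exp_has_derivative)

text \<open>A product of exp(- 1 / (z_i - a_i)) and exp(- 1 / (b_i - z_i)) over the coordinates,
  with value 0 off the box. The arguments have the shape \<open>z \<bullet> b + c\<close> required
  by \<open>Ck_up_to_flat_exp\<close>, hence the inner product with \<open>- i\<close>.\<close>

definition box_bump :: "'b::euclidean_space \<Rightarrow> 'b \<Rightarrow> 'b \<Rightarrow> real" where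
  "box_bump a b z = (\<Prod>i\<in>Basis. flat_exp 1 (z \<bullet> i + (- (a \<bullet> i))) * flat_exp 1 (z \<bullet> (- i) + b \<bullet> i))"

lemma flat_exp_1: "0 \<le> flat_exp 1 x" "flat_exp 1 x \<le> 1" "flat_exp 1 x > 0 \<longleftrightarrow> x > 0"
  by (auto simp: flat_exp_def)

lemma box_bump_range: "0 \<le> box_bump a b z" "box_bump a b z \<le> 1"
  unfolding box_bump_def
  by (auto intro!: prod_nonneg prod_le_1 mult_le_one mult_nonneg_nonneg simp: flat_exp_1)

lemma box_bump_pos: "z \<in> box a b \<Longrightarrow> box_bump a b z > 0"
  unfolding box_bump_def by (auto intro!: prod_pos mult_pos_pos simp: flat_exp_1 mem_box)

lemma box_bump_eq_0: "z \<notin> box a b \<Longrightarrow> box_bump a b z = 0"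
  unfolding box_bump_def by (force simp: mem_box flat_exp_def)

text \<open>The powers approximate the indicator of the box by test functions with support in the
  closed box, so that no mollification is needed.\<close>
definition box_cutoff :: "nat \<Rightarrow> 'b::euclidean_space \<Rightarrow> 'b \<Rightarrow> 'b \<Rightarrow> real" where
  "box_cutoff n a b z = 1 - (1 - box_bump a b z) ^ n"

lemma Ck_up_to_box_cutoff: "Ck_up_to D E k (box_cutoff n a b)"
proof -
  have "Ck_up_to D E k (box_bump a b)"
    unfolding box_bump_def
    by (intro Ck_up_to_prod Ck_up_to_mult Ck_up_to_flat_exp finite_Basis)
  then show ?thesis
    unfolding box_cutoff_def by (intro Ck_up_to_diff Ck_up_to_power Ck_up_to_const)
qed

lemma box_cutoff_range: "0 \<le> box_cutoff n a b z" "box_cutoff n a b z \<le> 1"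
  using box_bump_range[of a b z] by (auto simp: box_cutoff_def power_le_one)

lemma box_cutoff_eq_0: "z \<notin> box a b \<Longrightarrow> box_cutoff n a b z = 0"
  by (simp add: box_cutoff_def box_bump_eq_0)

lemma box_cutoff_tendsto: "(\<lambda>n. box_cutoff n a b z) \<longlonglongrightarrow> indicator (box a b) z"
proof (cases "z \<in> box a b")
  case True
  then have "(\<lambda>n. 1 - (1 - box_bump a b z) ^ n) \<longlonglongrightarrow> 1 - 0"
    using box_bump_pos[OF True] box_bump_range[of a b z]
    by (intro tendsto_diff tendsto_const LIMSEQ_realpow_zero) auto
  with True show ?thesis by (simp add: box_cutoff_def)
qed (simp add: box_cutoff_eq_0)

lemma box_cutoff_test_function:
  assumes "cbox a b \<subseteq> D"
  shows "box_cutoff n a b \<in> test_functions D"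
proof -
  have "{z \<in> D. box_cutoff n a b z \<noteq> 0} \<subseteq> cbox a b"
    using box_cutoff_eq_0[of _ a b n] box_subset_cbox by blast
  then have "closure {z \<in> D. box_cutoff n a b z \<noteq> 0} \<subseteq> cbox a b"
    by (intro closure_minimal closed_cbox)
  then show ?thesis
    using assms Ck_up_to_box_cutoff
    by (auto simp: test_functions_def smooth_up_to_def
        intro: compact_closure[THEN iffD2] bounded_subset[OF bounded_cbox order_trans[OF closure_subset]])
qed

section \<open>From vanishing integrals over boxes to the fundamental lemma\<close>

text \<open>Since \<open>ennreal\<close> truncates at 0, \<open>ennreal (F z)\<close> and
  \<open>ennreal (- F z)\<close> are the positive and the negative part. The measures with these
  densities agree on open boxes, a generator stable under intersection, and are finite on an
  exhausting sequence of boxes. They are therefore equal, so the densities agree almost everywhere,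
  and a number whose positive and negative parts coincide is 0.\<close>

lemma AE_zero_if_box_integrals_zero:
  fixes F :: "'b::euclidean_space \<Rightarrow> real"
  assumes int: "integrable lborel F"
    and zero: "\<And>a b. (LINT z|lborel. indicator (box a b) z * F z) = 0"
  shows "AE z in lborel. F z = 0"
proof -
  have [measurable]: "F \<in> borel_measurable borel" using int by auto
  have parts: "(\<integral>\<^sup>+z. ennreal (F z) * indicator (box a b) z \<partial>lborel)
      = (\<integral>\<^sup>+z. ennreal (- F z) * indicator (box a b) z \<partial>lborel)"
    "(\<integral>\<^sup>+z. ennreal (F z) * indicator (box a b) z \<partial>lborel) < \<infinity>" for a b
  proof -
    have *: "integrable lborel (\<lambda>z. indicator (box a b) z * F z)"
      using integrable_mult_indicator[OF _ int, of "box a b"] by simp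
    have eq: "ennreal (F z) * indicator (box a b) z = ennreal (max 0 (indicator (box a b) z * F z))"
      "ennreal (- F z) * indicator (box a b) z = ennreal (max 0 (- (indicator (box a b) z * F z)))" for z
      by (auto simp: indicator_def max_def ennreal_neg)
    have i: "integrable lborel (\<lambda>z. max 0 (indicator (box a b) z * F z))"
      "integrable lborel (\<lambda>z. max 0 (- (indicator (box a b) z * F z)))"
      using * by (auto intro!: integrable_max)
    have "(LINT z|lborel. max 0 (indicator (box a b) z * F z))
        - (LINT z|lborel. max 0 (- (indicator (box a b) z * F z)))
        = (LINT z|lborel. indicator (box a b) z * F z)"
      by (subst Bochner_Integration.integral_diff[OF i, symmetric])
         (auto intro!: Bochner_Integration.integral_cong simp: max_def)
    then show "(\<integral>\<^sup>+z. ennreal (F z) * indicator (box a b) z \<partial>lborel)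
      = (\<integral>\<^sup>+z. ennreal (- F z) * indicator (box a b) z \<partial>lborel)"
      "(\<integral>\<^sup>+z. ennreal (F z) * indicator (box a b) z \<partial>lborel) < \<infinity>"
      unfolding eq using i zero by (simp_all add: nn_integral_eq_integral)
  qed
  have "density lborel (\<lambda>z. ennreal (F z)) = density lborel (\<lambda>z. ennreal (- F z))"
  proof (rule measure_eqI_generator_eq)
    let ?E = "range (\<lambda>(a, b). box a b::'b set)"
    show "Int_stable ?E"
      by (auto simp: Int_stable_def box_Int_box)
    show "?E \<subseteq> Pow UNIV" by simp
    show "sets (density lborel (\<lambda>z. ennreal (F z))) = sigma_sets UNIV ?E"
      "sets (density lborel (\<lambda>z. ennreal (- F z))) = sigma_sets UNIV ?E"
      by (simp_all add: borel_eq_box)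
    let ?A = "\<lambda>n::nat. box (- (real n *\<^sub>R One)) (real n *\<^sub>R One) :: 'b set"
    show "range ?A \<subseteq> ?E" "(\<Union>i. ?A i) = UNIV"
      unfolding UN_box_eq_UNIV by auto
    show "emeasure (density lborel (\<lambda>z. ennreal (F z))) (?A i) \<noteq> \<infinity>" for i
      using parts(2) by (auto simp: emeasure_density less_top)
    show "emeasure (density lborel (\<lambda>z. ennreal (F z))) X
      = emeasure (density lborel (\<lambda>z. ennreal (- F z))) X" if "X \<in> ?E" for X
      using that parts(1) by (auto simp: emeasure_density)
  qed
  then have "AE z in lborel. ennreal (F z) = ennreal (- F z)"
    by (intro sigma_finite_measure.density_unique[OF sigma_finite_lborel]) auto
  then show ?thesis
    by eventually_elim (metis ennreal_eq_0_iff ennreal_neg linorder_le_cases neg_0_le_iff_le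
        neg_le_0_iff_le order_antisym)
qed

text \<open>The box generator describes the Borel sets, so the function is first replaced by a Borel
  representative; this changes no integral over a box.\<close>

lemma AE_lebesgue_zero_if_box_integrals_zero:
  fixes F :: "'b::euclidean_space \<Rightarrow> real"
  assumes int: "integrable lebesgue F"
    and zero: "\<And>a b. (LINT z|lebesgue. indicator (box a b) z * F z) = 0"
  shows "AE z in lebesgue. F z = 0"
proof -
  obtain F' where F': "F' \<in> borel_measurable lborel" "AE z in lborel. F z = F' z"
    using completion_ex_borel_measurable_real[of F lborel] int by auto
  have ae: "AE z in lebesgue. F z = F' z" using F'(2) by (rule AE_completion)
  have m: "F' \<in> borel_measurable lebesgue" using F'(1) by (rule measurable_completion)
  have "integrable lebesgue F'"
    using int m ae by (subst integrable_cong_AE[symmetric]) auto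
  then have "integrable lborel F'" using F'(1) by (simp add: integrable_completion)
  moreover have "(LINT z|lborel. indicator (box a b) z * F' z) = 0" for a b
  proof -
    have "(LINT z|lborel. indicator (box a b) z * F' z) = (LINT z|lebesgue. indicator (box a b) z * F' z)"
      using F'(1) by (subst integral_completion) auto
    also have "\<dots> = (LINT z|lebesgue. indicator (box a b) z * F z)"
      using ae int m
      by (intro integral_cong_AE borel_measurable_times borel_measurable_indicator) auto
    finally show ?thesis using zero by simp
  qed
  ultimately have "AE z in lborel. F' z = 0" by (rule AE_zero_if_box_integrals_zero)
  then have "AE z in lebesgue. F' z = 0" by (rule AE_completion)
  with ae show ?thesis by eventually_elim simp
qed

text \<open>Test functions see open boxes in the limit: the cutoffs lie between 0 and 1 and vanish
  off the box, so \<bar>f\<bar> on the closed box dominates. Local integrability gives a statement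
  on each closed box inside \<open>D\<close>, and countably many such boxes cover
  \<open>D\<close>.\<close>

lemma fundamental_lemma:
  fixes f :: "'b::euclidean_space \<Rightarrow> real"
  assumes D: "open D" and f: "locally_integrable_on D f"
    and zero: "\<And>\<phi>. \<phi> \<in> test_functions D \<Longrightarrow> (LINT z:D|lebesgue. f z * \<phi> z) = 0"
  shows "AE z in lebesgue. z \<in> D \<longrightarrow> f z = 0"
proof -
  have int: "integrable lebesgue (\<lambda>z. indicator (cbox a b) z * f z)" if "cbox a b \<subseteq> D" for a b
    using f that by (simp add: locally_integrable_on_def set_integrable_def)
  have box0: "(LINT z|lebesgue. indicator (box a b) z * f z) = 0" if ab: "cbox a b \<subseteq> D" for a b
  proof -
    have "(\<lambda>n. LINT z|lebesgue. box_cutoff n a b z * (indicator (cbox a b) z * f z))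
        \<longlonglongrightarrow> (LINT z|lebesgue. indicator (box a b) z * (indicator (cbox a b) z * f z))"
    proof (rule integral_dominated_convergence)
      show "integrable lebesgue (\<lambda>z. \<bar>indicator (cbox a b) z * f z\<bar>)"
        using int[OF ab] by (rule integrable_abs)
      have c: "continuous_on UNIV (box_cutoff n a b)" for n
        using Ck_up_to_box_cutoff[of UNIV UNIV 0 n a b] by simp
      show "(\<lambda>z. box_cutoff n a b z * (indicator (cbox a b) z * f z)) \<in> borel_measurable lebesgue" for n
        using int[OF ab] borel_measurable_continuous_onI[OF c]
        by (intro borel_measurable_times[OF measurable_completion borel_measurable_integrable]) auto
      show "(\<lambda>z. indicator (box a b) z * (indicator (cbox a b) z * f z)) \<in> borel_measurable lebesgue"
        using int[OF ab]
        by (intro borel_measurable_times[OF borel_measurable_indicator borel_measurable_integrable]) auto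
      show "AE z in lebesgue. (\<lambda>n. box_cutoff n a b z * (indicator (cbox a b) z * f z))
          \<longlonglongrightarrow> indicator (box a b) z * (indicator (cbox a b) z * f z)"
        by (intro AE_I2 tendsto_mult_right box_cutoff_tendsto)
      show "AE z in lebesgue. norm (box_cutoff n a b z * (indicator (cbox a b) z * f z))
          \<le> \<bar>indicator (cbox a b) z * f z\<bar>" for n
        using box_cutoff_range[of n a b]
        by (intro AE_I2) (auto simp: abs_mult intro!: mult_left_le_one_le)
    qed
    moreover have "(LINT z|lebesgue. box_cutoff n a b z * (indicator (cbox a b) z * f z)) = 0" for n
    proof -
      have eq: "(\<lambda>z. box_cutoff n a b z * (indicator (cbox a b) z * f z))
          = (\<lambda>z. indicator D z *\<^sub>R (f z * box_cutoff n a b z))"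
        using ab box_cutoff_eq_0[of _ a b n] box_subset_cbox[of a b]
        by (force simp: indicator_def fun_eq_iff)
      show ?thesis
        unfolding eq set_lebesgue_integral_def[symmetric]
        by (rule zero[OF box_cutoff_test_function[OF ab]])
    qed
    moreover have "(\<lambda>z. indicator (box a b) z * (indicator (cbox a b) z * f z)) = (\<lambda>z. indicator (box a b) z * f z)"
      using box_subset_cbox[of a b] by (auto simp: indicator_def fun_eq_iff)
    ultimately show ?thesis by (simp only: LIMSEQ_const_iff)
  qed
  have cbox0: "AE z in lebesgue. z \<in> cbox a b \<longrightarrow> f z = 0" if ab: "cbox a b \<subseteq> D" for a b
  proof -
    have "integrable lebesgue (\<lambda>z. indicator (box a b) z * (indicator (cbox a b) z * f z))"
      using integrable_mult_indicator[OF _ int[OF ab], of "box a b"] by simp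
    moreover have "(\<lambda>z. indicator (box a b) z * (indicator (cbox a b) z * f z)) = (\<lambda>z. indicator (box a b) z * f z)"
      using box_subset_cbox[of a b] by (auto simp: indicator_def fun_eq_iff)
    ultimately have "integrable lebesgue (\<lambda>z. indicator (box a b) z * f z)" by (simp only:)
    \<comment> \<open>Truncation to \<open>box a b\<close> makes the function integrable on the
      whole space; testing it with another box gives an integral over the intersection. That is
      again a box, and if non-empty its closure stays inside \<open>cbox a b\<close>, hence inside
      \<open>D\<close>.\<close>
    moreover have "(LINT z|lebesgue. indicator (box p q) z * (indicator (box a b) z * f z)) = 0" for p q
    proof -
      obtain c d where cd: "box p q \<inter> box a b = box c d"
        using that[OF box_Int_box] by blast
      have eq: "(\<lambda>z. indicator (box p q) z * (indicator (box a b) z * f z)) = (\<lambda>z. indicator (box c d) z * f z)"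
        unfolding cd[symmetric] by (auto simp: indicator_def fun_eq_iff)
      show ?thesis
      proof (cases "box c d = {}")
        case False
        then have "cbox c d \<subseteq> cbox a b"
          using cd closure_box[OF False] box_subset_cbox[of a b]
          by (metis Int_lower2 closed_cbox closure_minimal subset_trans)
        then show ?thesis unfolding eq using box0 ab by blast
      qed (simp only: eq, simp)
    qed
    ultimately have "AE z in lebesgue. indicator (box a b) z * f z = 0"
      by (rule AE_lebesgue_zero_if_box_integrals_zero)
    \<comment> \<open>The vanishing is known on open boxes while the cover of \<open>D\<close>
      consists of closed ones; the difference is a null set.\<close>
    moreover have "AE z in lebesgue. z \<notin> cbox a b - box a b"
      using negligible_frontier_interval[of a b] by (intro AE_not_in) (simp add: negligible_iff_null_sets)
    ultimately show ?thesis by eventually_elim (auto simp: indicator_def)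
  qed
  obtain \<D> where \<D>: "countable \<D>" "\<D> \<subseteq> Pow D" "\<forall>X\<in>\<D>. \<exists>a b. X = cbox a b" "\<Union>\<D> = D"
    using open_countable_Union_open_cbox[OF D] by (metis (no_types, lifting))
  have "AE z in lebesgue. \<forall>X\<in>\<D>. z \<in> X \<longrightarrow> f z = 0"
    unfolding AE_ball_countable[OF \<D>(1)]
  proof
    fix X assume X: "X \<in> \<D>"
    then obtain a b where "X = cbox a b" using \<D>(3) by blast
    with X \<D>(2) cbox0[of a b] show "AE z in lebesgue. z \<in> X \<longrightarrow> f z = 0" by auto
  qed
  then show ?thesis using \<D>(4) by (auto elim: eventually_mono)
qed

section \<open>Weak and classical gradients\<close>

lemma Ck_up_to_subset: "Ck_up_to D E k f \<Longrightarrow> E' \<subseteq> E \<Longrightarrow> Ck_up_to D E' k f"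
proof (induction k arbitrary: f)
  case (Suc k)
  show ?case
  proof (rule Ck_up_to_SucI)
    show "continuous_on E' f"
      using Ck_up_to_continuous_on[OF Suc.prems(1)] Suc.prems(2) by (rule continuous_on_subset)
    show "(f has_derivative frechet_derivative f (at z)) (at z)" if "z \<in> D" for z
      using Suc.prems(1) that by (rule Ck_up_to_has_derivative)
    fix i :: 'a assume "i \<in> Basis"
    with Suc.prems(1) obtain g where
      "\<forall>z\<in>D. g z = frechet_derivative f (at z) i" "Ck_up_to D E k g"
      by (rule Ck_up_to_SucE)
    then show "\<exists>g. (\<forall>z\<in>D. g z = frechet_derivative f (at z) i) \<and> Ck_up_to D E' k g"
      using Suc.IH Suc.prems(2) by blast
  qed
qed (auto intro: continuous_on_subset)

lemma Ck_up_to_continuous_on_frechet_derivative: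
  assumes "Ck_up_to D D (Suc k) f" "i \<in> Basis"
  shows "continuous_on D (\<lambda>z. frechet_derivative f (at z) i)"
proof -
  obtain g where g: "\<forall>z\<in>D. g z = frechet_derivative f (at z) i" "Ck_up_to D D k g"
    using assms by (rule Ck_up_to_SucE)
  then show ?thesis
    using continuous_on_cong[of D D g] Ck_up_to_continuous_on[OF g(2)] by auto
qed

section \<open>Integration by parts against test functions\<close>

lemma continuous_on_extend_by_zero:
  fixes f :: "'b::t2_space \<Rightarrow> real"
  assumes "open D" "compact K" "K \<subseteq> D" "continuous_on D f" "\<And>z. z \<in> D - K \<Longrightarrow> f z = 0"
  shows "continuous_on UNIV (\<lambda>z. if z \<in> D then f z else 0)"
proof -
  have "continuous_on D (\<lambda>z. if z \<in> D then f z else 0)"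
    using assms(4) by (simp cong: continuous_on_cong)
  moreover have "continuous_on (- K) (\<lambda>z. if z \<in> D then f z else 0)"
    using assms(5) by (intro continuous_on_eq[OF continuous_on_const[of _ 0]]) auto
  ultimately have "continuous_on (D \<union> - K) (\<lambda>z. if z \<in> D then f z else 0)"
    using assms(1,2) by (intro continuous_on_open_Un) (auto intro: compact_imp_closed)
  moreover have "D \<union> - K = UNIV" using assms(3) by auto
  ultimately show ?thesis by simp
qed

lemma integrable_continuous_compact_support:
  fixes f :: "'b::euclidean_space \<Rightarrow> real"
  assumes "compact K" "continuous_on UNIV f" "\<And>z. z \<notin> K \<Longrightarrow> f z = 0"
  shows "integrable lborel f"
proof -
  have "integrable lborel (\<lambda>z. indicator K z *\<^sub>R f z)"
    using assms(1) continuous_on_subset[OF assms(2)] by (intro borel_integrable_compact) auto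
  moreover have "(\<lambda>z. indicator K z *\<^sub>R f z) = f"
    using assms(3) by (auto simp: indicator_def fun_eq_iff)
  ultimately show ?thesis by simp
qed

lemma integral_translate_lborel:
  fixes f :: "'b::euclidean_space \<Rightarrow> real"
  assumes "integrable lborel f"
  shows "integrable lborel (\<lambda>z. f (z + c))" "(LINT z|lborel. f (z + c)) = (LINT z|lborel. f z)"
proof -
  have f: "f \<in> borel_measurable borel" using assms by auto
  have m: "(+) c \<in> measurable lborel borel" by simp
  show "integrable lborel (\<lambda>z. f (z + c))"
    using integrable_distr_eq[OF m f] assms by (simp add: lborel_distr_plus add.commute)
  show "(LINT z|lborel. f (z + c)) = (LINT z|lborel. f z)"
    using integral_distr[OF m f] by (simp add: lborel_distr_plus add.commute)
qed

text \<open>The integral of a difference quotient vanishes by translation invariance, which avoids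
  iterated integrals along coordinate lines.\<close>
lemma integral_directional_derivative_eq_0:
  fixes P q :: "'b::euclidean_space \<Rightarrow> real"
  assumes K: "compact K"
    and der: "\<And>z. ((\<lambda>t. P (z + t *\<^sub>R i)) has_real_derivative q z) (at 0)"
    and P: "continuous_on UNIV P" "\<And>z. z \<notin> K \<Longrightarrow> P z = 0"
    and q: "continuous_on UNIV q" "\<And>z. z \<notin> K \<Longrightarrow> q z = 0"
  shows "(LINT z|lborel. q z) = 0"
proof -
  \<comment> \<open>Step sizes tending to 0 and bounded by 1; the bound keeps the supports of all
    difference quotients in one ball.\<close>
  define h where "h n = 1 / real (Suc n)" for n
  have h: "0 < h n" "h n \<le> 1" for n by (auto simp: h_def)
  obtain R where R: "\<And>z. z \<in> K \<Longrightarrow> norm z \<le> R"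
    using compact_imp_bounded[OF K] by (auto simp: bounded_iff)
  have "bounded (q ` K)"
    using K q(1) by (intro compact_imp_bounded compact_continuous_image) (auto intro: continuous_on_subset)
  then obtain M0 where M0: "\<And>z. z \<in> K \<Longrightarrow> \<bar>q z\<bar> \<le> M0"
    by (auto simp: bounded_iff)
  define M where "M = max M0 0"
  have M: "\<bar>q z\<bar> \<le> M" for z
    using M0[of z] q(2)[of z] by (cases "z \<in> K") (auto simp: M_def)
  have intP: "integrable lborel P" by (rule integrable_continuous_compact_support[OF K P])
  define Q where "Q n z = (P (z + h n *\<^sub>R i) - P z) / h n" for n z
  have "(\<lambda>n. LINT z|lborel. Q n z) \<longlonglongrightarrow> (LINT z|lborel. q z)"
  proof (rule integral_dominated_convergence)
    \<comment> \<open>If \<open>z\<close> lies outside this ball, both \<open>z\<close> and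
      \<open>z + h n *\<^sub>R i\<close> have norm larger than \<open>R\<close>, so the quotient
      vanishes. Inside, the mean value theorem bounds it by \<open>M\<close>.\<close>
    let ?B = "cball (0::'b) (R + norm i)"
    show "integrable lborel (\<lambda>z. indicator ?B z * M)"
      using borel_integrable_compact[of ?B "\<lambda>_. M"] by simp
    show "q \<in> borel_measurable lborel" using q(1) by (simp add: borel_measurable_continuous_onI)
    show "Q n \<in> borel_measurable lborel" for n
      unfolding Q_def using intP integral_translate_lborel(1)[OF intP] by auto
    show "AE z in lborel. (\<lambda>n. Q n z) \<longlonglongrightarrow> q z"
    proof (rule AE_I2)
      fix z
      have "((\<lambda>t. (P (z + t *\<^sub>R i) - P z) / t) \<longlongrightarrow> q z) (at 0)"
        using der[of z] by (simp add: DERIV_def)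
      moreover have "filterlim h (at 0) sequentially"
        unfolding filterlim_at h_def using LIMSEQ_inverse_real_of_nat
        by (auto simp: inverse_eq_divide)
      ultimately show "(\<lambda>n. Q n z) \<longlonglongrightarrow> q z"
        unfolding Q_def by (rule filterlim_compose)
    qed
    show "AE z in lborel. norm (Q n z) \<le> indicator ?B z * M" for n
    proof (rule AE_I2)
      fix z
      show "norm (Q n z) \<le> indicator ?B z * M"
      proof (cases "z \<in> ?B")
        case True
        \<comment> \<open>The hypothesis gives the derivative at parameter 0 for every base point;
          moving the base point along the line gives it at every parameter.\<close>
        have d: "((\<lambda>t. P (z + t *\<^sub>R i)) has_real_derivative q (z + t *\<^sub>R i)) (at t)" for t
          using der[of "z + t *\<^sub>R i"] DERIV_shift[of "\<lambda>t. P (z + t *\<^sub>R i)" _ 0 t]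
          by (simp add: algebra_simps)
        obtain \<xi> where "P (z + h n *\<^sub>R i) - P (z + 0 *\<^sub>R i) = (h n - 0) * q (z + \<xi> *\<^sub>R i)"
          using MVT2[OF h(1)[of n], of "\<lambda>t. P (z + t *\<^sub>R i)" "\<lambda>t. q (z + t *\<^sub>R i)"] d by blast
        then have "Q n z = q (z + \<xi> *\<^sub>R i)" using h(1)[of n] by (simp add: Q_def)
        then show ?thesis using True M by simp
      next
        case False
        have "norm (h n *\<^sub>R i) \<le> norm i" using h[of n] by (simp add: mult_left_le_one_le)
        then have "norm z - norm i \<le> norm (z + h n *\<^sub>R i)"
          using norm_diff_ineq[of z "h n *\<^sub>R i"] by linarith
        with False have "z \<notin> K" "z + h n *\<^sub>R i \<notin> K" using R norm_ge_zero[of i] by (force simp del: norm_ge_zero)+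
        then show ?thesis using False P(2) by (simp add: Q_def)
      qed
    qed
  qed
  moreover have "(LINT z|lborel. Q n z) = 0" for n
    using integral_translate_lborel[OF intP] intP by (simp add: Q_def)
  ultimately show ?thesis by (simp add: LIMSEQ_const_iff)
qed

text \<open>Membership in \<open>test_functions D\<close> says nothing about values outside
  \<open>D\<close>, so vanishing is claimed on \<open>D - K\<close> only. There the derivative
  vanishes too, because \<open>D - K\<close> is open.\<close>

lemma test_function_support:
  assumes "\<phi> \<in> test_functions D" "open D"
  obtains K where "compact K" "K \<subseteq> D" "\<forall>z\<in>D - K. \<phi> z = 0"
    "\<forall>z\<in>D - K. frechet_derivative \<phi> (at z) = (\<lambda>_. 0)"
proof (rule that)
  let ?K = "closure {z \<in> D. \<phi> z \<noteq> 0}"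
  show K: "compact ?K" "?K \<subseteq> D" using assms(1) by (auto simp: test_functions_def)
  show *: "\<forall>z\<in>D - ?K. \<phi> z = 0"
    using closure_subset[of "{z \<in> D. \<phi> z \<noteq> 0}"] by blast
  show "\<forall>z\<in>D - ?K. frechet_derivative \<phi> (at z) = (\<lambda>_. 0)"
  proof
    fix z assume z: "z \<in> D - ?K"
    have "open (D - ?K)" using assms(2) by auto
    with has_derivative_const[of 0 "at z"] have "(\<phi> has_derivative (\<lambda>_. 0)) (at z)"
      using z by (rule has_derivative_transform_within_open) (use * in \<open>simp only:\<close>)
    then show "frechet_derivative \<phi> (at z) = (\<lambda>_. 0)" by (rule frechet_derivative_at[symmetric])
  qed
qed

lemma test_functions_Ck_up_to: "\<phi> \<in> test_functions D \<Longrightarrow> Ck_up_to D D k \<phi>"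
  by (simp add: test_functions_def smooth_up_to_def)

text \<open>The product of \<open>v\<close> and \<open>\<phi>\<close>, extended by zero, is
  compactly supported and differentiable everywhere, so its derivative along \<open>i\<close> has
  integral 0; the Leibniz rule splits this integral into the two sides.\<close>

lemma integration_by_parts:
  fixes v \<phi> :: "'b::euclidean_space \<Rightarrow> real"
  assumes D: "open D" and v: "Ck_up_to D D 1 v" and \<phi>: "\<phi> \<in> test_functions D" and i: "i \<in> Basis"
  shows "(LINT z:D|lebesgue. v z * frechet_derivative \<phi> (at z) i)
    = - (LINT z:D|lebesgue. frechet_derivative v (at z) i * \<phi> z)"
proof -
  obtain K where K: "compact K" "K \<subseteq> D" "\<forall>z\<in>D - K. \<phi> z = 0"
    "\<forall>z\<in>D - K. frechet_derivative \<phi> (at z) = (\<lambda>_. 0)"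
    using test_function_support[OF \<phi> D] .
  let ?v' = "\<lambda>z. frechet_derivative v (at z) i" and ?\<phi>' = "\<lambda>z. frechet_derivative \<phi> (at z) i"
  \<comment> \<open>Values of \<open>v\<close> and \<open>\<phi>\<close> outside \<open>D\<close>
    are arbitrary, hence the explicit extension by zero before integrating over the whole
    space.\<close>
  define ext :: "('b \<Rightarrow> real) \<Rightarrow> 'b \<Rightarrow> real" where "ext f = (\<lambda>z. if z \<in> D then f z else 0)" for f
  note v = v[unfolded One_nat_def] and \<phi>1 = test_functions_Ck_up_to[OF \<phi>, of "Suc 0"]
  have cv: "continuous_on D v" "continuous_on D ?v'" "continuous_on D \<phi>" "continuous_on D ?\<phi>'"
    using v \<phi>1 i by (auto intro: Ck_up_to_continuous_on Ck_up_to_continuous_on_frechet_derivative)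
  have ext_props: "continuous_on UNIV (ext f)" "integrable lborel (ext f)" "\<And>z. z \<notin> K \<Longrightarrow> ext f z = 0"
    if "continuous_on D f" "\<And>z. z \<in> D - K \<Longrightarrow> f z = 0" for f
  proof -
    show 1: "continuous_on UNIV (ext f)" unfolding ext_def
      by (rule continuous_on_extend_by_zero[OF D K(1,2) that])
    show 2: "\<And>z. z \<notin> K \<Longrightarrow> ext f z = 0" using that(2) by (auto simp: ext_def)
    show "integrable lborel (ext f)"
      by (rule integrable_continuous_compact_support[OF K(1) 1 2])
  qed
  have LINT: "(LINT z:D|lebesgue. f z) = (LINT z|lborel. ext f z)"
    if "continuous_on D f" "\<And>z. z \<in> D - K \<Longrightarrow> f z = 0" for f
  proof -
    have "(\<lambda>z. indicator D z *\<^sub>R f z) = ext f" by (auto simp: ext_def indicator_def)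
    then show ?thesis using ext_props(2)[OF that] by (simp add: set_lebesgue_integral_def integral_completion)
  qed
  have c: "continuous_on D (\<lambda>z. v z * \<phi> z)" "continuous_on D (\<lambda>z. v z * ?\<phi>' z)"
    "continuous_on D (\<lambda>z. ?v' z * \<phi> z)" "continuous_on D (\<lambda>z. v z * ?\<phi>' z + ?v' z * \<phi> z)"
    by (intro continuous_intros cv)+
  have z: "v z * \<phi> z = 0" "v z * ?\<phi>' z = 0" "?v' z * \<phi> z = 0" "v z * ?\<phi>' z + ?v' z * \<phi> z = 0"
    if "z \<in> D - K" for z
    using K(3,4) that by simp_all
  have "(LINT z|lborel. ext (\<lambda>z. v z * ?\<phi>' z + ?v' z * \<phi> z) z) = 0"
  proof (rule integral_directional_derivative_eq_0[OF K(1)])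
    show "((\<lambda>t. ext (\<lambda>z. v z * \<phi> z) (z + t *\<^sub>R i)) has_real_derivative
        ext (\<lambda>z. v z * ?\<phi>' z + ?v' z * \<phi> z) z) (at 0)" for z
    proof -
      have "\<exists>P'. (ext (\<lambda>z. v z * \<phi> z) has_derivative P') (at z) \<and> P' i = ext (\<lambda>z. v z * ?\<phi>' z + ?v' z * \<phi> z) z"
      proof (cases "z \<in> D")
        case True
        have "((\<lambda>z. v z * \<phi> z) has_derivative
          (\<lambda>h. v z * frechet_derivative \<phi> (at z) h + frechet_derivative v (at z) h * \<phi> z)) (at z)"
          by (intro has_derivative_mult Ck_up_to_has_derivative[OF v True] Ck_up_to_has_derivative[OF \<phi>1 True])
        then have "(ext (\<lambda>z. v z * \<phi> z) has_derivative
          (\<lambda>h. v z * frechet_derivative \<phi> (at z) h + frechet_derivative v (at z) h * \<phi> z)) (at z)"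
          using D True by (rule has_derivative_transform_within_open) (auto simp: ext_def)
        then show ?thesis using True by (intro exI conjI) (auto simp: ext_def)
      next
        case False
        \<comment> \<open>A point outside \<open>D\<close> lies in the complement of
          \<open>K\<close>, which is open, and there the extension is identically zero.\<close>
        have "(ext (\<lambda>z. v z * \<phi> z) has_derivative (\<lambda>_. 0)) (at z)"
          using compact_imp_closed[OF K(1)] False K(2,3)
          by (intro has_derivative_transform_within_open[OF has_derivative_const[of 0], of "- K"])
             (auto simp: ext_def)
        then show ?thesis using False by (intro exI conjI) (auto simp: ext_def)
      qed
      then obtain P' where P': "(ext (\<lambda>z. v z * \<phi> z) has_derivative P') (at z)"
        "P' i = ext (\<lambda>z. v z * ?\<phi>' z + ?v' z * \<phi> z) z" by blast
      have "((\<lambda>t. z + t *\<^sub>R i) has_derivative (\<lambda>t. t *\<^sub>R i)) (at 0)"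
        by (auto intro!: derivative_eq_intros)
      then have "((\<lambda>t. ext (\<lambda>z. v z * \<phi> z) (z + t *\<^sub>R i)) has_derivative (\<lambda>t. P' (t *\<^sub>R i))) (at 0)"
        using has_derivative_compose[of "\<lambda>t. z + t *\<^sub>R i" "\<lambda>t. t *\<^sub>R i" 0 UNIV "ext (\<lambda>z. v z * \<phi> z)" P'] P'(1)
        by simp
      then show ?thesis
        unfolding has_field_derivative_def
        by (rule has_derivative_eq_rhs)
           (use P'(2) linear_cmul[OF has_derivative_linear[OF P'(1)], of _ i] in \<open>auto simp: mult.commute\<close>)
    qed
    show "continuous_on UNIV (ext (\<lambda>z. v z * \<phi> z))"
      "continuous_on UNIV (ext (\<lambda>z. v z * ?\<phi>' z + ?v' z * \<phi> z))"
      by (rule ext_props(1)[OF c(1) z(1)] ext_props(1)[OF c(4) z(4)]; assumption)+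
    show "ext (\<lambda>z. v z * \<phi> z) z = 0" "ext (\<lambda>z. v z * ?\<phi>' z + ?v' z * \<phi> z) z = 0" if "z \<notin> K" for z
      by (rule ext_props(3)[OF c(1) z(1) that] ext_props(3)[OF c(4) z(4) that]; assumption)+
  qed
  moreover have "ext (\<lambda>z. v z * ?\<phi>' z + ?v' z * \<phi> z) = (\<lambda>z. ext (\<lambda>z. v z * ?\<phi>' z) z + ext (\<lambda>z. ?v' z * \<phi> z) z)"
    by (rule HOL.ext) (simp add: ext_def)
  ultimately have "(LINT z|lborel. ext (\<lambda>z. v z * ?\<phi>' z) z) + (LINT z|lborel. ext (\<lambda>z. ?v' z * \<phi> z) z) = 0"
    using Bochner_Integration.integral_add[OF ext_props(2)[OF c(2) z(2)] ext_props(2)[OF c(3) z(3)]] by (simp only:)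
  moreover have "(LINT z:D|lebesgue. v z * ?\<phi>' z) = (LINT z|lborel. ext (\<lambda>z. v z * ?\<phi>' z) z)"
    by (rule LINT[OF c(2) z(2)])
  moreover have "(LINT z:D|lebesgue. ?v' z * \<phi> z) = (LINT z|lborel. ext (\<lambda>z. ?v' z * \<phi> z) z)"
    by (rule LINT[OF c(3) z(3)])
  ultimately show ?thesis by linarith
qed

definition classical_gradient :: "('b::euclidean_space \<Rightarrow> real) \<Rightarrow> 'b \<Rightarrow> 'b" where
  "classical_gradient v z = (\<Sum>i\<in>Basis. frechet_derivative v (at z) i *\<^sub>R i)"

lemma classical_gradient_inner:
  "i \<in> Basis \<Longrightarrow> classical_gradient v z \<bullet> i = frechet_derivative v (at z) i"
  by (simp add: classical_gradient_def inner_sum_left inner_Basis if_distrib sum.delta cong: if_cong)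

lemma continuous_imp_locally_integrable_on:
  fixes f :: "'b::euclidean_space \<Rightarrow> 'c::euclidean_space"
  assumes "continuous_on D f"
  shows "locally_integrable_on D f"
  unfolding locally_integrable_on_def
proof (intro allI impI)
  fix K assume K: "compact K \<and> K \<subseteq> D"
  then have "continuous_on K f" using assms continuous_on_subset by blast
  with K have "integrable lborel (\<lambda>z. indicator K z *\<^sub>R f z)"
    by (intro borel_integrable_compact) auto
  then show "f absolutely_integrable_on K"
    unfolding set_integrable_def by (subst integrable_completion) auto
qed

lemma has_weak_gradient_classical:
  assumes D: "open D" and v: "Ck_up_to D D 1 v"
  shows "has_weak_gradient D v (classical_gradient v)"
  unfolding has_weak_gradient_def
proof (intro conjI ballI)
  show "locally_integrable_on D v"
    using v by (intro continuous_imp_locally_integrable_on Ck_up_to_continuous_on)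
  have "continuous_on D (classical_gradient v)"
    unfolding classical_gradient_def
    using v by (intro continuous_intros) (simp only: One_nat_def Ck_up_to_continuous_on_frechet_derivative)
  then show "locally_integrable_on D (classical_gradient v)"
    by (rule continuous_imp_locally_integrable_on)
  show "(LINT z:D|lebesgue. v z * frechet_derivative \<phi> (at z) i)
      = - (LINT z:D|lebesgue. (classical_gradient v z \<bullet> i) * \<phi> z)"
    if "\<phi> \<in> test_functions D" "i \<in> Basis" for \<phi> i
    using integration_by_parts[OF D v that] that(2) by (simp add: classical_gradient_inner)
qed

section \<open>Local integrability and uniqueness of weak gradients\<close>

lemma locally_integrable_on_add:
  "locally_integrable_on D f \<Longrightarrow> locally_integrable_on D g \<Longrightarrow> locally_integrable_on D (\<lambda>z. f z + g z)"
  unfolding locally_integrable_on_def by (blast intro: set_integral_add(1))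

lemma locally_integrable_on_scaleR:
  "locally_integrable_on D f \<Longrightarrow> locally_integrable_on D (\<lambda>z. c *\<^sub>R f z)"
  unfolding locally_integrable_on_def by (blast intro: absolutely_integrable_scaleR_left)

lemma locally_integrable_on_inner:
  "locally_integrable_on D g \<Longrightarrow> locally_integrable_on D (\<lambda>z. g z \<bullet> i)"
  unfolding locally_integrable_on_def by (blast intro: absolutely_integrable_component)

text \<open>Local integrability controls compact pieces only; measurability on all of
  \<open>D\<close> is glued from a countable cover by closed boxes.\<close>

lemma locally_integrable_on_borel_measurable:
  fixes f :: "'b::euclidean_space \<Rightarrow> 'c::euclidean_space"
  assumes D: "open D" and f: "locally_integrable_on D f"
  shows "f \<in> borel_measurable (lebesgue_on D)"
proof -
  obtain \<D> where \<D>: "countable \<D>" "\<D> \<subseteq> Pow D" "\<forall>X\<in>\<D>. \<exists>a b. X = cbox a b" "\<Union>\<D> = D"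
    using open_countable_Union_open_cbox[OF D] by (metis (no_types, lifting))
  have DL: "D \<in> sets lebesgue" using D by (intro sets_completionI_sets) simp
  show ?thesis
  proof (rule measurable_piecewise_restrict[OF \<D>(1)])
    fix X assume X: "X \<in> \<D>"
    then obtain a b where ab: "X = cbox a b" using \<D>(3) by blast
    have XD: "X \<subseteq> D" using X \<D>(2) by blast
    have XL: "X \<in> sets lebesgue" "compact X" using ab by simp_all
    have "X \<in> sets (lebesgue_on D)"
      using DL XL(1) XD sets_restrict_space_iff[of D lebesgue X] by simp
    moreover have "X \<inter> space (lebesgue_on D) = X" using XD by auto
    ultimately show "X \<inter> space (lebesgue_on D) \<in> sets (lebesgue_on D)" by (simp only:)
    have "f absolutely_integrable_on X"
      using f XD XL(2) by (simp only: locally_integrable_on_def)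
    then have "f \<in> borel_measurable (lebesgue_on X)"
      using XL(1) by (rule absolutely_integrable_imp_borel_measurable)
    moreover have "restrict_space (lebesgue_on D) X = lebesgue_on X"
      using restrict_restrict_space[of D lebesgue X] DL XL(1) XD by (simp add: Int_absorb1)
    ultimately show "f \<in> borel_measurable (restrict_space (lebesgue_on D) X)" by (simp only:)
  qed (use \<D>(4) in simp)
qed

text \<open>The product vanishes on \<open>D - K\<close>, and on \<open>K\<close> it is an
  integrable function times a bounded measurable one.\<close>

lemma locally_integrable_times_compact_support:
  fixes f \<phi> :: "'b::euclidean_space \<Rightarrow> real"
  assumes f: "locally_integrable_on D f" and K: "compact K" "K \<subseteq> D"
    and \<phi>: "continuous_on D \<phi>" "\<forall>z\<in>D - K. \<phi> z = 0"
  shows "set_integrable lebesgue D (\<lambda>z. f z * \<phi> z)"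
proof -
  have KL: "K \<in> sets lebesgue" using K(1) by (simp add: compact_imp_closed sets_completionI_sets)
  have c: "continuous_on K \<phi>" using \<phi>(1) K(2) by (rule continuous_on_subset)
  have "(\<lambda>z. \<phi> z * f z) absolutely_integrable_on K"
  proof (rule absolutely_integrable_bounded_measurable_product[OF bilinear_times _ KL])
    show "\<phi> \<in> borel_measurable (lebesgue_on K)"
      using c KL by (rule continuous_imp_measurable_on_sets_lebesgue)
    show "bounded (\<phi> ` K)" using compact_continuous_image[OF c K(1)] by (rule compact_imp_bounded)
    show "f absolutely_integrable_on K" using f K by (simp add: locally_integrable_on_def)
  qed
  moreover have "(\<lambda>z. indicator K z *\<^sub>R (\<phi> z * f z)) = (\<lambda>z. indicator D z *\<^sub>R (f z * \<phi> z))"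
  proof
    fix z show "indicator K z *\<^sub>R (\<phi> z * f z) = indicator D z *\<^sub>R (f z * \<phi> z)"
      using K(2) \<phi>(2) by (cases "z \<in> K"; cases "z \<in> D") auto
  qed
  ultimately show ?thesis by (simp only: set_integrable_def)
qed

lemma test_function_integrable:
  assumes D: "open D" and f: "locally_integrable_on D f" and \<phi>: "\<phi> \<in> test_functions D"
  shows "set_integrable lebesgue D (\<lambda>z. f z * \<phi> z)"
    and "i \<in> Basis \<Longrightarrow> set_integrable lebesgue D (\<lambda>z. f z * frechet_derivative \<phi> (at z) i)"
proof -
  obtain K where K: "compact K" "K \<subseteq> D" "\<forall>z\<in>D - K. \<phi> z = 0"
    "\<forall>z\<in>D - K. frechet_derivative \<phi> (at z) = (\<lambda>_. 0)"
    using test_function_support[OF \<phi> D] .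
  note \<phi>1 = test_functions_Ck_up_to[OF \<phi>, of "Suc 0"]
  show "set_integrable lebesgue D (\<lambda>z. f z * \<phi> z)"
    by (rule locally_integrable_times_compact_support[OF f K(1,2) Ck_up_to_continuous_on[OF \<phi>1] K(3)])
  show "set_integrable lebesgue D (\<lambda>z. f z * frechet_derivative \<phi> (at z) i)" if "i \<in> Basis"
    using Ck_up_to_continuous_on_frechet_derivative[OF \<phi>1 that] K(4)
    by (intro locally_integrable_times_compact_support[OF f K(1,2)]) auto
qed

text \<open>Each component of the difference of the gradients integrates to zero against every test
  function, so the fundamental lemma applies. Allowing \<open>u\<close> and \<open>v\<close> to
  differ on a null set later makes the norm and the trace depend on classes only.\<close>

lemma has_weak_gradient_unique:
  fixes D :: "'b::euclidean_space set"
  assumes D: "open D" and g: "has_weak_gradient D u g" and h: "has_weak_gradient D v h"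
    and uv: "AE z in lebesgue_on D. u z = v z"
  shows "AE z in lebesgue_on D. g z = h z"
proof -
  have DL: "D \<in> sets lebesgue" using D by (intro sets_completionI_sets) simp
  have lg: "locally_integrable_on D g" and lh: "locally_integrable_on D h"
    and lu: "locally_integrable_on D u" and lv: "locally_integrable_on D v"
    using g h by (auto simp: has_weak_gradient_def)
  have uv: "AE z in lebesgue. z \<in> D \<longrightarrow> u z = v z" using uv DL by (simp add: AE_restrict_space_iff)
  have "AE z in lebesgue. z \<in> D \<longrightarrow> g z \<bullet> i + (- 1) *\<^sub>R (h z \<bullet> i) = 0" if i: "i \<in> Basis" for i
  proof (rule fundamental_lemma[OF D])
    show "locally_integrable_on D (\<lambda>z. g z \<bullet> i + (- 1) *\<^sub>R (h z \<bullet> i))"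
      using lg lh by (intro locally_integrable_on_add locally_integrable_on_scaleR locally_integrable_on_inner)
    fix \<phi> assume \<phi>: "\<phi> \<in> test_functions D"
    have "(LINT z:D|lebesgue. u z * frechet_derivative \<phi> (at z) i)
        = (LINT z:D|lebesgue. v z * frechet_derivative \<phi> (at z) i)"
      unfolding set_lebesgue_integral_def
    proof (rule integral_cong_AE)
      show "AE z in lebesgue. indicator D z *\<^sub>R (u z * frechet_derivative \<phi> (at z) i)
          = indicator D z *\<^sub>R (v z * frechet_derivative \<phi> (at z) i)"
        using uv by eventually_elim (simp add: indicator_def)
    qed (use test_function_integrable(2)[OF D lu \<phi> i] test_function_integrable(2)[OF D lv \<phi> i] in
      \<open>simp_all only: set_integrable_def borel_measurable_integrable\<close>)
    moreover have "(LINT z:D|lebesgue. u z * frechet_derivative \<phi> (at z) i) = - (LINT z:D|lebesgue. (g z \<bullet> i) * \<phi> z)"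
      "(LINT z:D|lebesgue. v z * frechet_derivative \<phi> (at z) i) = - (LINT z:D|lebesgue. (h z \<bullet> i) * \<phi> z)"
      using g h \<phi> i unfolding has_weak_gradient_def by blast+
    ultimately have "(LINT z:D|lebesgue. (g z \<bullet> i) * \<phi> z) = (LINT z:D|lebesgue. (h z \<bullet> i) * \<phi> z)"
      by linarith
    moreover have "set_integrable lebesgue D (\<lambda>z. (g z \<bullet> i) * \<phi> z)" "set_integrable lebesgue D (\<lambda>z. (h z \<bullet> i) * \<phi> z)"
      using lg lh D \<phi> by (auto intro: test_function_integrable locally_integrable_on_inner)
    ultimately show "(LINT z:D|lebesgue. (g z \<bullet> i + (- 1) *\<^sub>R (h z \<bullet> i)) * \<phi> z) = 0"
      by (simp add: left_diff_distrib)
  qed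
  then have "AE z in lebesgue. \<forall>i\<in>Basis. z \<in> D \<longrightarrow> g z \<bullet> i + (- 1) *\<^sub>R (h z \<bullet> i) = 0"
    by (intro AE_finite_allI) auto
  then have "AE z in lebesgue. z \<in> D \<longrightarrow> g z = h z"
    by eventually_elim (auto intro: euclidean_eqI)
  then show ?thesis using DL by (simp add: AE_restrict_space_iff)
qed

lemma has_weak_gradient_add:
  assumes D: "open D" and g: "has_weak_gradient D u g" and h: "has_weak_gradient D v h"
  shows "has_weak_gradient D (\<lambda>z. u z + v z) (\<lambda>z. g z + h z)"
  unfolding has_weak_gradient_def
proof (intro conjI ballI)
  have l: "locally_integrable_on D g" "locally_integrable_on D h"
    "locally_integrable_on D u" "locally_integrable_on D v"
    using g h by (auto simp: has_weak_gradient_def)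
  then show "locally_integrable_on D (\<lambda>z. u z + v z)" "locally_integrable_on D (\<lambda>z. g z + h z)"
    by (auto intro: locally_integrable_on_add)
  fix \<phi> i assume \<phi>: "\<phi> \<in> test_functions D" and i: "i \<in> (Basis :: 'a set)"
  have "(LINT z:D|lebesgue. (u z + v z) * frechet_derivative \<phi> (at z) i)
      = (LINT z:D|lebesgue. u z * frechet_derivative \<phi> (at z) i) + (LINT z:D|lebesgue. v z * frechet_derivative \<phi> (at z) i)"
    using test_function_integrable(2)[OF D l(3) \<phi> i] test_function_integrable(2)[OF D l(4) \<phi> i]
    by (simp add: distrib_right)
  also have "\<dots> = - (LINT z:D|lebesgue. (g z \<bullet> i) * \<phi> z) - (LINT z:D|lebesgue. (h z \<bullet> i) * \<phi> z)"
    using g h \<phi> i by (simp add: has_weak_gradient_def)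
  also have "\<dots> = - (LINT z:D|lebesgue. ((g z + h z) \<bullet> i) * \<phi> z)"
    using test_function_integrable(1)[OF D locally_integrable_on_inner[OF l(1)] \<phi>, of i]
      test_function_integrable(1)[OF D locally_integrable_on_inner[OF l(2)] \<phi>, of i]
    by (simp add: distrib_right inner_add_left)
  finally show "(LINT z:D|lebesgue. (u z + v z) * frechet_derivative \<phi> (at z) i)
      = - (LINT z:D|lebesgue. ((g z + h z) \<bullet> i) * \<phi> z)" .
qed

lemma has_weak_gradient_mult:
  assumes g: "has_weak_gradient D u g"
  shows "has_weak_gradient D (\<lambda>z. c * u z) (\<lambda>z. c *\<^sub>R g z)"
  using g locally_integrable_on_scaleR[of D u c] locally_integrable_on_scaleR[of D g c]
  by (auto simp: has_weak_gradient_def mult.assoc)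

lemma has_weak_gradient_diff:
  assumes "open D" "has_weak_gradient D u g" "has_weak_gradient D v h"
  shows "has_weak_gradient D (\<lambda>z. u z - v z) (\<lambda>z. g z - h z)"
  using has_weak_gradient_add[OF assms(1,2) has_weak_gradient_mult[OF assms(3), of "-1"]] by simp

lemma weak_gradient:
  assumes "has_weak_gradient D u g"
  shows "has_weak_gradient D u (weak_gradient D u)"
  unfolding weak_gradient_def by (rule someI[where P = "has_weak_gradient D u", OF assms])

section \<open>The trace inequality\<close>

text \<open>Put n = integral of \<bar>g\<bar>. Then \<bar>f 0\<bar> \<le> \<bar>f y\<bar> + n for
  every y, and the Cauchy-Schwarz inequality gives 2 n^2 \<le> J / s. Hence (f 0)^2 - J / s \<le> 2
  (f y)^2 for all y, and integrating against the weight \<open>y\<close>, a lower bound for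
  \<open>y powr (1 - 2 * s)\<close>, yields (f 0)^2 \<le> 4 A + J / s, where \<open>A\<close> and
  \<open>J\<close> are the weighted integrals of f^2 and g^2.\<close>

lemma trace_inequality_interval:
  fixes f g :: "real \<Rightarrow> real"
  assumes s: "0 < s" "s \<le> 1"
    and f: "continuous_on {0..1} f" "\<And>y. y \<in> {0<..<1} \<Longrightarrow> (f has_real_derivative g y) (at y)"
    and g: "continuous_on {0..1} g"
  shows "ennreal ((f 0)\<^sup>2 * s\<^sup>2)
    \<le> 4 * (\<integral>\<^sup>+y. ennreal (y powr (1 - 2 * s) * ((f y)\<^sup>2 + (g y)\<^sup>2)) * indicator {0<..<1} y \<partial>lborel)"
proof -
  define I where "I = {0<..<1::real}"
  have [measurable]: "I \<in> sets borel" by (simp add: I_def)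
  define w where "w y = y powr (1 - 2 * s)" for y :: real
  define A where "A = (\<integral>\<^sup>+y. ennreal (w y * (f y)\<^sup>2) * indicator I y \<partial>lborel)"
  define J where "J = (\<integral>\<^sup>+y. ennreal (w y * (g y)\<^sup>2) * indicator I y \<partial>lborel)"
  have I01: "I \<subseteq> {0..1}" by (auto simp: I_def)
  have w0: "0 \<le> w y" for y by (simp add: w_def)
  have [measurable]: "w \<in> borel_measurable borel" unfolding w_def by measurable
  \<comment> \<open>Continuity is known on the unit interval only; cutting off with the indicator
    gives Borel functions on the line, as the rules for integrals over \<open>lborel\<close>
    require.\<close>
  define fI where "fI y = indicator I y *\<^sub>R f y" for y
  define gI where "gI y = indicator I y *\<^sub>R g y" for y
  have [measurable]: "fI \<in> borel_measurable borel" "gI \<in> borel_measurable borel"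
    unfolding fI_def gI_def using continuous_on_subset[OF f(1) I01] continuous_on_subset[OF g I01]
    by (intro borel_measurable_continuous_on_indicator; simp)+
  have sum: "(\<integral>\<^sup>+y. ennreal (w y * ((f y)\<^sup>2 + (g y)\<^sup>2)) * indicator I y \<partial>lborel) = A + J"
  proof -
    have "(\<integral>\<^sup>+y. ennreal (w y * ((f y)\<^sup>2 + (g y)\<^sup>2)) * indicator I y \<partial>lborel)
      = (\<integral>\<^sup>+y. ennreal (w y * (fI y)\<^sup>2) + ennreal (w y * (gI y)\<^sup>2) \<partial>lborel)"
      using w0 by (intro nn_integral_cong) (auto simp: fI_def gI_def indicator_def ennreal_plus[symmetric] distrib_left simp del: ennreal_plus)
    also have "\<dots> = (\<integral>\<^sup>+y. ennreal (w y * (fI y)\<^sup>2) \<partial>lborel) + (\<integral>\<^sup>+y. ennreal (w y * (gI y)\<^sup>2) \<partial>lborel)"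
      by (intro nn_integral_add) measurable
    also have "\<dots> = A + J"
      unfolding A_def J_def by (intro arg_cong2[where f = "(+)"] nn_integral_cong) (auto simp: fI_def gI_def indicator_def)
    finally show ?thesis .
  qed
  have "ennreal ((f 0)\<^sup>2 * s\<^sup>2) \<le> 4 * (A + J)"
  proof (cases "A = \<infinity> \<or> J = \<infinity>")
    case True
    then show ?thesis by (auto simp: ennreal_mult_top)
  next
    case False
    then obtain a j where aj: "A = ennreal a" "0 \<le> a" "J = ennreal j" "0 \<le> j"
      by (metis ennreal_cases infinity_ennreal_def)
    define n where "n = integral {0..1} (\<lambda>y. \<bar>g y\<bar>)"
    have gi: "g integrable_on {0..1}" "(\<lambda>y. \<bar>g y\<bar>) integrable_on {0..1}"
      using g by (auto intro!: integrable_continuous_real continuous_intros)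
    have n0: "0 \<le> n" unfolding n_def by (intro integral_nonneg gi) simp
    have nI: "((\<lambda>y. \<bar>g y\<bar>) has_integral n) I"
      using gi(2) unfolding n_def I_def by (simp add: has_integral_Icc_iff_Ioo[symmetric] has_integral_integral)
    have N: "(\<integral>\<^sup>+y. ennreal \<bar>g y\<bar> * indicator I y \<partial>lborel) = ennreal n"
      by (rule nn_integral_has_integral_lebesgue'[OF _ nI]) simp
    have f0: "\<bar>f 0\<bar> \<le> \<bar>f y\<bar> + n" if y: "y \<in> I" for y
    proof -
      have "(g has_integral (f y - f 0)) {0..y}"
        using y by (intro fundamental_theorem_of_calculus_interior continuous_on_subset[OF f(1)])
          (auto simp: I_def has_real_derivative_iff_has_vector_derivative[symmetric] intro!: f(2))
      then have "f y - f 0 = integral {0..y} g" by (simp add: integral_unique)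
      moreover have "\<bar>integral {0..y} g\<bar> \<le> integral {0..y} (\<lambda>y. \<bar>g y\<bar>)"
        unfolding real_norm_def[symmetric] using y gi
        by (intro integral_norm_bound_integral)
           (auto simp: I_def intro: integrable_on_subinterval[where S = "{0..1}"])
      moreover have "integral {0..y} (\<lambda>y. \<bar>g y\<bar>) \<le> n"
        unfolding n_def using y gi
        by (intro integral_subset_le) (auto simp: I_def intro: integrable_on_subinterval[where S = "{0..1}"])
      ultimately show ?thesis by linarith
    qed
    \<comment> \<open>The exponent exceeds -1 because \<open>s > 0\<close>. In the Cauchy-Schwarz
      step below, 1 is split as \<open>y powr (s - 1/2)\<close> times
      \<open>y powr (1/2 - s)\<close>: the square of the first factor is this integrand, the square
      of the second is the weight in \<open>J\<close>.\<close>
    have "((\<lambda>y. y powr (2 * s - 1)) has_integral (1 powr (2 * s - 1 + 1) / (2 * s - 1 + 1))) {0..1}"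
      using s by (intro has_integral_powr_from_0) auto
    then have pI: "((\<lambda>y. y powr (2 * s - 1)) has_integral 1 / (2 * s)) I"
      by (simp add: I_def has_integral_Icc_iff_Ioo[symmetric])
    have pN: "(\<integral>\<^sup>+y. ennreal (y powr (2 * s - 1)) * indicator I y \<partial>lborel) = ennreal (1 / (2 * s))"
      by (rule nn_integral_has_integral_lebesgue'[OF _ pI]) simp
    have "(\<integral>\<^sup>+y. ennreal (y powr (s - 1/2) * indicator I y) * ennreal (y powr (1/2 - s) * \<bar>gI y\<bar>) \<partial>lborel)\<^sup>2
      \<le> (\<integral>\<^sup>+y. (ennreal (y powr (s - 1/2) * indicator I y))\<^sup>2 \<partial>lborel)
        * (\<integral>\<^sup>+y. (ennreal (y powr (1/2 - s) * \<bar>gI y\<bar>))\<^sup>2 \<partial>lborel)"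
      by (intro Cauchy_Schwarz_nn_integral) measurable
    also have "(\<integral>\<^sup>+y. (ennreal (y powr (s - 1/2) * indicator I y))\<^sup>2 \<partial>lborel) = ennreal (1 / (2 * s))"
      unfolding pN[symmetric]
      by (intro nn_integral_cong)
         (auto simp: fI_def gI_def indicator_def power2_eq_square ennreal_mult[symmetric] powr_add[symmetric] I_def)
    also have "(\<integral>\<^sup>+y. (ennreal (y powr (1/2 - s) * \<bar>gI y\<bar>))\<^sup>2 \<partial>lborel) = J"
      unfolding J_def w_def
      by (intro nn_integral_cong)
         (auto simp: fI_def gI_def indicator_def ennreal_power power_mult_distrib power2_eq_square[of "_ powr _"] powr_add[symmetric] I_def)
    also have "(\<integral>\<^sup>+y. ennreal (y powr (s - 1/2) * indicator I y) * ennreal (y powr (1/2 - s) * \<bar>gI y\<bar>) \<partial>lborel)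
        = ennreal n"
      unfolding N[symmetric]
      by (intro nn_integral_cong)
         (auto simp: fI_def gI_def indicator_def I_def ennreal_mult[symmetric] mult.assoc[symmetric] powr_add[symmetric])
    finally have "n\<^sup>2 \<le> 1 / (2 * s) * j"
      using aj s n0 by (simp add: ennreal_power ennreal_mult[symmetric])
    then have nj: "2 * n\<^sup>2 \<le> j / s" using s by (simp add: field_simps)
    have pt: "(f 0)\<^sup>2 - j / s \<le> 2 * (f y)\<^sup>2" if "y \<in> I" for y
    proof -
      have "(f 0)\<^sup>2 \<le> (\<bar>f y\<bar> + n)\<^sup>2"
        using f0[OF that] n0 by (metis abs_ge_zero power2_abs power_mono)
      also have "\<dots> \<le> 2 * (f y)\<^sup>2 + 2 * n\<^sup>2"
        using sum_squares_bound[of "\<bar>f y\<bar>" n] by (simp add: power2_sum)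
      finally show ?thesis using nj by linarith
    qed
    have "(f 0)\<^sup>2 - j / s \<le> 4 * a"
    proof (cases "(f 0)\<^sup>2 - j / s \<le> 0")
      case False
      \<comment> \<open>When this difference is at most 0 the claim is trivial; when it is positive,
        the constant \<open>c\<close> can be compared with f^2 inside a non-negative
        integral.\<close>
      define c where "c = (f 0)\<^sup>2 - j / s"
      have c: "c > 0" using False by (simp add: c_def)
      have "((\<lambda>y. c * y) has_integral (c / 2 * 1\<^sup>2 - c / 2 * 0\<^sup>2)) {0..1}"
        by (rule fundamental_theorem_of_calculus)
           (auto intro!: derivative_eq_intros simp: has_real_derivative_iff_has_vector_derivative[symmetric])
      then have cI: "((\<lambda>y. c * y) has_integral c / 2) I"
        by (simp add: I_def has_integral_Icc_iff_Ioo[symmetric])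
      have "ennreal (c / 2) = (\<integral>\<^sup>+y. ennreal (c * y) * indicator I y \<partial>lborel)"
        by (rule nn_integral_has_integral_lebesgue'[OF _ cI, symmetric]) (use c in \<open>auto simp: I_def\<close>)
      also have "\<dots> \<le> (\<integral>\<^sup>+y. 2 * (ennreal (w y * (fI y)\<^sup>2)) \<partial>lborel)"
      proof (rule nn_integral_mono)
        fix y :: real
        show "ennreal (c * y) * indicator I y \<le> 2 * ennreal (w y * (fI y)\<^sup>2)"
        proof (cases "y \<in> I")
          case True
          then have y: "0 < y" "y < 1" by (auto simp: I_def)
          \<comment> \<open>The exponent \<open>1 - 2 * s\<close> is at most 1 and
            \<open>y < 1\<close>. This minorant of the weight does not depend on \<open>s\<close>,
            and its integral 1/2 turns \<open>2 * a\<close> into \<open>4 * a\<close>.\<close>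
          have "y powr 1 \<le> w y" unfolding w_def using y s by (intro powr_mono') auto
          then have "c * y \<le> 2 * (f y)\<^sup>2 * w y"
            using pt[OF True] y c by (intro mult_mono) (auto simp: c_def)
          then have "ennreal (c * y) \<le> ennreal (2 * (w y * (f y)\<^sup>2))"
            by (intro ennreal_leI) (simp add: mult_ac)
          then show ?thesis using True by (simp add: fI_def ennreal_mult')
        qed (simp add: fI_def)
      qed
      also have "\<dots> = 2 * (\<integral>\<^sup>+y. ennreal (w y * (fI y)\<^sup>2) \<partial>lborel)"
        by (intro nn_integral_cmult) measurable
      also have "(\<integral>\<^sup>+y. ennreal (w y * (fI y)\<^sup>2) \<partial>lborel) = A"
        unfolding A_def by (intro nn_integral_cong) (auto simp: fI_def gI_def indicator_def)
      finally have "ennreal (c / 2) \<le> ennreal (2 * a)"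
        using aj by (simp add: ennreal_mult')
      then show ?thesis using aj by (simp add: c_def)
    qed (use aj in linarith)
    \<comment> \<open>Multiplication by \<open>s\<^sup>2\<close> removes the singular factor:
      \<open>j / s\<close> becomes \<open>j * s\<close>, and \<open>s \<le> 1\<close> bounds both
      terms uniformly.\<close>
    then have "(f 0)\<^sup>2 * s\<^sup>2 \<le> (4 * a + j / s) * s\<^sup>2"
      by (intro mult_right_mono) auto
    also have "\<dots> = 4 * a * s\<^sup>2 + j * s" using s by (simp add: field_simps power2_eq_square)
    also have "\<dots> \<le> 4 * a * 1 + j * 1"
      using s aj by (intro add_mono mult_left_mono) (auto simp: power_le_one)
    also have "\<dots> \<le> 4 * (a + j)" using aj by simp
    finally show ?thesis
      using aj by (simp add: ennreal_plus[symmetric] ennreal_mult'[symmetric] ennreal_leI del: ennreal_plus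
          flip: ennreal_numeral)
  qed
  then show ?thesis using sum by (simp add: I_def w_def)
qed

text \<open>A null set times the whole space has measure 0 times infinity, which is 0. Exceptional
  sets of the exponent in the base thus stay negligible in the cylinder.\<close>

lemma AE_lborel_fst:
  assumes "AE x in lborel. P x"
  shows "AE z in lborel. P (fst (z :: 'a::euclidean_space \<times> 'b::euclidean_space))"
proof -
  obtain N where N: "N \<in> null_sets lborel" "{x. \<not> P x} \<subseteq> N"
    using assms by (auto simp: eventually_ae_filter)
  have "N \<times> (UNIV::'b set) \<in> null_sets (lborel \<Otimes>\<^sub>M lborel)"
    using N(1) by (auto simp: null_sets_def lborel.emeasure_pair_measure_Times)
  then have "N \<times> (UNIV::'b set) \<in> null_sets lborel" by (simp add: lborel_prod)
  then show ?thesis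
    by (rule AE_I') (use N(2) in auto)
qed

lemma open_cylinder: "open \<Omega> \<Longrightarrow> open (cylinder \<Omega>)"
  unfolding cylinder_def by (intro open_Times open_greaterThan)

lemma closure_cylinder: "closure (cylinder \<Omega>) = closure \<Omega> \<times> {0..}"
  unfolding cylinder_def by (simp add: closure_Times)

text \<open>Uniqueness makes the choice inside \<open>weak_gradient\<close> irrelevant: the squared
  norm may be computed with any weak gradient at hand, in particular with the classical one.\<close>

lemma H_norm_sq_eq:
  assumes "open \<Omega>" "has_weak_gradient (cylinder \<Omega>) u g"
  shows "H_norm_sq \<Omega> \<delta> u = (\<integral>\<^sup>+z. ennreal (snd z powr \<delta> (fst z) * (\<bar>u z\<bar>\<^sup>2 + (norm (g z))\<^sup>2))
    \<partial>lebesgue_on (cylinder \<Omega>))"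
  unfolding H_norm_sq_def
proof (rule nn_integral_cong_AE)
  have "AE z in lebesgue_on (cylinder \<Omega>). weak_gradient (cylinder \<Omega>) u z = g z"
    using has_weak_gradient_unique[OF open_cylinder[OF assms(1)] weak_gradient[OF assms(2)] assms(2)] by simp
  then show "AE z in lebesgue_on (cylinder \<Omega>).
      ennreal (snd z powr \<delta> (fst z) * (\<bar>u z\<bar>\<^sup>2 + (norm (weak_gradient (cylinder \<Omega>) u z))\<^sup>2))
      = ennreal (snd z powr \<delta> (fst z) * (\<bar>u z\<bar>\<^sup>2 + (norm (g z))\<^sup>2))"
    by eventually_elim simp
qed

lemma smooth_cylinder_Ck_up_to:
  "v \<in> smooth_cylinder \<Omega> \<Longrightarrow> Ck_up_to (cylinder \<Omega>) (closure (cylinder \<Omega>)) k v"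
  by (simp add: smooth_cylinder_def smooth_up_to_def)

lemma smooth_cylinder_has_weak_gradient:
  assumes "open \<Omega>" "v \<in> smooth_cylinder \<Omega>"
  shows "has_weak_gradient (cylinder \<Omega>) v (classical_gradient v)"
  using Ck_up_to_subset[OF smooth_cylinder_Ck_up_to[OF assms(2)] closure_subset] open_cylinder[OF assms(1)]
  by (intro has_weak_gradient_classical)

lemma nn_integral_lebesgue_on:
  fixes S :: "'b::euclidean_space set"
  assumes "S \<in> sets lebesgue"
  shows "(\<integral>\<^sup>+x. f x \<partial>lebesgue_on S) = (\<integral>\<^sup>+x. f x * indicator S x \<partial>lborel)"
  using assms by (simp add: nn_integral_restrict_space nn_integral_completion)

text \<open>The inequality on vertical segments is integrated over the base by Tonelli's theorem. It
  uses the slab of height 1 only, and there the vertical derivative is one component of the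
  gradient.\<close>

lemma trace_inequality:
  fixes \<Omega> :: "'a::euclidean_space set"
  assumes \<Omega>: "open \<Omega>" and s: "s \<in> borel_measurable (lebesgue_on \<Omega>)"
    and s01: "AE x in lebesgue_on \<Omega>. 0 \<le> s x \<and> s x \<le> 1"
    and v: "v \<in> smooth_cylinder \<Omega>"
  shows "(\<integral>\<^sup>+x. ennreal (\<bar>v (x, 0)\<bar>\<^sup>2 * (s x)\<^sup>2) \<partial>lebesgue_on \<Omega>) \<le> 4 * H_norm_sq \<Omega> (\<lambda>x. 1 - 2 * s x) v"
proof -
  let ?D = "cylinder \<Omega>"
  have \<Omega>L: "\<Omega> \<in> sets lebesgue" "?D \<in> sets lebesgue"
    using \<Omega> open_cylinder[OF \<Omega>] by (auto intro: sets_completionI_sets)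
  have s01: "AE x in lborel. x \<in> \<Omega> \<longrightarrow> 0 \<le> s x \<and> s x \<le> 1"
    using s01 \<Omega>L by (simp add: AE_restrict_space_iff AE_completion_iff imp_conjR)
  have "(\<lambda>x. if x \<in> \<Omega> then s x else 0) \<in> borel_measurable lebesgue"
    using s \<Omega>L(1) by (rule borel_measurable_if_I)
  \<comment> \<open>Tonelli's theorem is applied to a Borel integrand on the product, whereas
    \<open>s\<close> is Lebesgue measurable; a Borel representative \<open>s'\<close> replaces
    it.\<close>
  then obtain s' where s' [measurable]: "s' \<in> borel_measurable borel"
    and "AE x in lborel. (if x \<in> \<Omega> then s x else 0) = s' x"
    using completion_ex_borel_measurable_real[of "\<lambda>x. if x \<in> \<Omega> then s x else 0" lborel] by auto
  then have ss': "AE x in lborel. x \<in> \<Omega> \<longrightarrow> s x = s' x"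
    by (auto elim: eventually_mono)
  define E where "E = closure ?D"
  note vC = smooth_cylinder_Ck_up_to[OF v, folded E_def]
  have b: "(0, 1) \<in> (Basis :: ('a \<times> real) set)" by (simp add: Basis_prod_def)
  \<comment> \<open>Smoothness up to the boundary supplies a continuous extension of the vertical
    derivative to height 0, which the inequality on segments requires.\<close>
  obtain G where G: "\<forall>z\<in>?D. G z = frechet_derivative v (at z) (0, 1)" "Ck_up_to ?D E 0 G"
    using vC[of "Suc 0"] b by (rule Ck_up_to_SucE)
  have cont: "continuous_on E v" "continuous_on E G"
    using Ck_up_to_continuous_on[OF vC[of 0]] Ck_up_to_continuous_on[OF G(2)] .
  have E: "\<Omega> \<times> {0..} \<subseteq> E" unfolding E_def closure_cylinder using closure_subset by auto
  define vE where "vE z = indicator E z *\<^sub>R v z" for z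
  define GE where "GE z = indicator E z *\<^sub>R G z" for z
  have EB: "E \<in> sets borel" by (simp add: E_def)
  have [measurable]: "vE \<in> borel_measurable borel" "GE \<in> borel_measurable borel"
    unfolding vE_def GE_def using cont EB by (intro borel_measurable_continuous_on_indicator; simp)+
  have [measurable]: "(fst :: 'a \<times> real \<Rightarrow> 'a) \<in> measurable borel borel" "(snd :: 'a \<times> real \<Rightarrow> real) \<in> measurable borel borel"
    by (intro borel_measurable_continuous_onI continuous_intros)+
  have [measurable]: "\<Omega> \<times> {0<..<1::real} \<in> sets borel"
    using \<Omega> by (intro borel_open open_Times) auto
  define F where "F z = ennreal (snd z powr (1 - 2 * s' (fst z)) * ((vE z)\<^sup>2 + (GE z)\<^sup>2))
      * indicator (\<Omega> \<times> {0<..<1}) z" for z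
  have F: "F \<in> borel_measurable borel" unfolding F_def by measurable
  have F': "F \<in> borel_measurable (lborel \<Otimes>\<^sub>M lborel)" using F by (simp add: lborel_prod)
  have "(\<integral>\<^sup>+x. ennreal (\<bar>v (x, 0)\<bar>\<^sup>2 * (s x)\<^sup>2) \<partial>lebesgue_on \<Omega>)
      = (\<integral>\<^sup>+x. ennreal (\<bar>v (x, 0)\<bar>\<^sup>2 * (s x)\<^sup>2) * indicator \<Omega> x \<partial>lborel)"
    by (rule nn_integral_lebesgue_on[OF \<Omega>L(1)])
  also have "\<dots> \<le> (\<integral>\<^sup>+x. 4 * (\<integral>\<^sup>+y. F (x, y) \<partial>lborel) \<partial>lborel)"
  proof (rule nn_integral_mono_AE)
    show "AE x in lborel. ennreal (\<bar>v (x, 0)\<bar>\<^sup>2 * (s x)\<^sup>2) * indicator \<Omega> x \<le> 4 * (\<integral>\<^sup>+y. F (x, y) \<partial>lborel)"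
      using s01 ss'
    proof eventually_elim
      case (elim x)
      \<comment> \<open>Where \<open>s x = 0\<close> the left side is 0, so the inequality on
        segments is needed for positive \<open>s x\<close> only.\<close>
      show ?case
      proof (cases "x \<in> \<Omega> \<and> s x \<noteq> 0")
        case True
        then have x: "x \<in> \<Omega>" "0 < s x" "s x \<le> 1" "s' x = s x" using elim by auto
        have xE: "(\<lambda>y. (x, y)) ` {0..1} \<subseteq> E" using x(1) E by auto
        have c: "continuous_on {0..1} (\<lambda>y. v (x, y))" "continuous_on {0..1} (\<lambda>y. G (x, y))"
          using xE by (auto intro!: continuous_on_compose2[OF cont(1)] continuous_on_compose2[OF cont(2)] continuous_intros)
        have d: "((\<lambda>y. v (x, y)) has_real_derivative G (x, y)) (at y)" if "y \<in> {0<..<1}" for y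
        proof -
          have z: "(x, y) \<in> ?D" using x(1) that by (simp add: cylinder_def)
          have 1: "((\<lambda>y. (x, y)) has_derivative (\<lambda>h. (0, h))) (at y)"
            by (auto intro!: derivative_eq_intros)
          have 2: "(v has_derivative frechet_derivative v (at (x, y))) (at (x, y))"
            using vC[of "Suc 0"] z by (rule Ck_up_to_has_derivative)
          have "((\<lambda>y. v (x, y)) has_derivative (\<lambda>h. frechet_derivative v (at (x, y)) (0, h))) (at y)"
            using has_derivative_compose[OF 1 2] .
          moreover have "frechet_derivative v (at (x, y)) (0, h) = G (x, y) * h" for h
            using linear_cmul[OF has_derivative_linear[OF 2], of h "(0, 1)"] G(1) z by simp
          ultimately show ?thesis by (simp add: has_field_derivative_def)
        qed
        have "(x, y) \<in> E" if "0 < y" for y using E x(1) that by auto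
        then have "(\<integral>\<^sup>+y. ennreal (y powr (1 - 2 * s x) * ((v (x, y))\<^sup>2 + (G (x, y))\<^sup>2)) * indicator {0<..<1} y \<partial>lborel)
            = (\<integral>\<^sup>+y. F (x, y) \<partial>lborel)"
          using x by (intro nn_integral_cong) (auto simp: F_def vE_def GE_def indicator_def)
        then show ?thesis
          using trace_inequality_interval[OF x(2,3) c(1) d c(2)] x(1) by simp
      qed auto
    qed
  qed
  also have "\<dots> = 4 * (\<integral>\<^sup>+x. (\<integral>\<^sup>+y. F (x, y) \<partial>lborel) \<partial>lborel)"
    using lborel.borel_measurable_nn_integral_fst[OF F'] by (rule nn_integral_cmult)
  also have "(\<integral>\<^sup>+x. (\<integral>\<^sup>+y. F (x, y) \<partial>lborel) \<partial>lborel) = (\<integral>\<^sup>+z. F z \<partial>lborel)"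
    using lborel.nn_integral_fst[OF F'] by (simp add: lborel_prod)
  also have "\<dots> \<le> (\<integral>\<^sup>+z. ennreal (snd z powr (1 - 2 * s (fst z)) * (\<bar>v z\<bar>\<^sup>2 + (norm (classical_gradient v z))\<^sup>2)) * indicator ?D z \<partial>lborel)"
  proof (rule nn_integral_mono_AE)
    show "AE z in lborel. F z \<le> ennreal (snd z powr (1 - 2 * s (fst z)) * (\<bar>v z\<bar>\<^sup>2 + (norm (classical_gradient v z))\<^sup>2)) * indicator ?D z"
      using AE_lborel_fst[OF ss']
    proof eventually_elim
      case (elim z)
      show ?case
      proof (cases "z \<in> \<Omega> \<times> {0<..<1}")
        case True
        then have z: "z \<in> ?D" "z \<in> E" "s (fst z) = s' (fst z)"
          using elim E by (auto simp: cylinder_def)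
        have "\<bar>G z\<bar> \<le> norm (classical_gradient v z)"
          using Basis_le_norm[OF b, of "classical_gradient v z"] classical_gradient_inner[OF b, of v z] G(1) z by simp
        then have "(G z)\<^sup>2 \<le> (norm (classical_gradient v z))\<^sup>2" by (metis abs_ge_zero power2_abs power_mono)
        then show ?thesis
          using z True by (auto simp: F_def vE_def GE_def intro!: ennreal_leI mult_left_mono)
      qed (simp add: F_def)
    qed
  qed
  also have "\<dots> = H_norm_sq \<Omega> (\<lambda>x. 1 - 2 * s x) v"
    unfolding H_norm_sq_eq[OF \<Omega> smooth_cylinder_has_weak_gradient[OF \<Omega> v]]
    by (rule nn_integral_lebesgue_on[OF \<Omega>L(2), symmetric])
  finally show ?thesis by (simp add: mult_left_mono)
qed

section \<open>Smooth functions on the cylinder\<close>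

lemma smooth_cylinder_add:
  "u \<in> smooth_cylinder \<Omega> \<Longrightarrow> v \<in> smooth_cylinder \<Omega> \<Longrightarrow> (\<lambda>z. u z + v z) \<in> smooth_cylinder \<Omega>"
  by (simp add: smooth_cylinder_def smooth_up_to_def Ck_up_to_add)

lemma smooth_cylinder_mult: "u \<in> smooth_cylinder \<Omega> \<Longrightarrow> (\<lambda>z. c * u z) \<in> smooth_cylinder \<Omega>"
  by (simp add: smooth_cylinder_def smooth_up_to_def Ck_up_to_mult Ck_up_to_const)

lemma smooth_cylinder_diff:
  "u \<in> smooth_cylinder \<Omega> \<Longrightarrow> v \<in> smooth_cylinder \<Omega> \<Longrightarrow> (\<lambda>z. u z - v z) \<in> smooth_cylinder \<Omega>"
  by (simp add: smooth_cylinder_def smooth_up_to_def Ck_up_to_diff)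

lemma smooth_cylinder_c_subset: "smooth_cylinder_c \<Omega> \<subseteq> smooth_cylinder \<Omega>"
  by (auto simp: smooth_cylinder_c_def)

text \<open>If \<open>w\<close> vanishes wherever both \<open>u\<close> and \<open>v\<close> do, its
  support is a closed subset of the union of two compact ones. Sums and multiples are both covered;
  for multiples take \<open>v = u\<close>.\<close>

lemma smooth_cylinder_c_I:
  assumes w: "w \<in> smooth_cylinder \<Omega>" and u: "u \<in> smooth_cylinder_c \<Omega>" and v: "v \<in> smooth_cylinder_c \<Omega>"
    and zero: "\<And>z. u z = 0 \<Longrightarrow> v z = 0 \<Longrightarrow> w z = 0"
  shows "w \<in> smooth_cylinder_c \<Omega>"
proof -
  let ?supp = "\<lambda>f. closure {z \<in> closure (cylinder \<Omega>). f z \<noteq> (0::real)}"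
  have *: "{z \<in> closure (cylinder \<Omega>). w z \<noteq> 0}
      \<subseteq> {z \<in> closure (cylinder \<Omega>). u z \<noteq> 0} \<union> {z \<in> closure (cylinder \<Omega>). v z \<noteq> 0}"
    using zero by blast
  then have sub: "?supp w \<subseteq> ?supp u \<union> ?supp v"
    using closure_mono[OF *] by (simp only: closure_Un)
  have uv: "compact (?supp u \<union> ?supp v)" "?supp u \<union> ?supp v \<subseteq> cylinder_base \<Omega>"
    using u v unfolding smooth_cylinder_c_def by (simp_all only: mem_Collect_eq compact_Un Un_least)
  have "compact ((?supp u \<union> ?supp v) \<inter> ?supp w)"
    using uv(1) closed_closure by (rule compact_Int_closed)
  then have "compact (?supp w)" using sub by (simp only: Int_absorb1)
  then show ?thesis using w sub uv(2) by (simp only: smooth_cylinder_c_def mem_Collect_eq) blast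
qed

lemma smooth_cylinder_c_add:
  "u \<in> smooth_cylinder_c \<Omega> \<Longrightarrow> v \<in> smooth_cylinder_c \<Omega> \<Longrightarrow> (\<lambda>z. u z + v z) \<in> smooth_cylinder_c \<Omega>"
  by (rule smooth_cylinder_c_I[where u = u and v = v, OF smooth_cylinder_add])
     (simp_all add: subsetD[OF smooth_cylinder_c_subset])

lemma smooth_cylinder_c_mult: "u \<in> smooth_cylinder_c \<Omega> \<Longrightarrow> (\<lambda>z. c * u z) \<in> smooth_cylinder_c \<Omega>"
  by (rule smooth_cylinder_c_I[where u = u and v = u, OF smooth_cylinder_mult])
     (simp_all add: subsetD[OF smooth_cylinder_c_subset])

section \<open>Weighted norms and traces\<close>

lemma ennreal_double_sum: "0 \<le> a \<Longrightarrow> 0 \<le> b \<Longrightarrow> ennreal (2 * a + 2 * b) = 2 * ennreal a + 2 * ennreal b"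
  by (simp add: ennreal_plus ennreal_mult')

text \<open>\<open>enn2real\<close> sends infinity to 0, so real norms carry information only where
  the squares are finite. This lemma and the next one pass between the two scales.\<close>

lemma norm_le_if_norm_sq_le:
  assumes "a \<le> ennreal (k\<^sup>2) * b" "b < \<infinity>" "0 \<le> k"
  shows "sqrt (enn2real a) \<le> k * sqrt (enn2real b)"
proof -
  have "enn2real a \<le> enn2real (ennreal (k\<^sup>2) * b)"
    using assms(1,2) by (intro enn2real_mono) (auto simp: ennreal_mult_less_top)
  then have "sqrt (enn2real a) \<le> sqrt (k\<^sup>2 * enn2real b)"
    by (simp add: enn2real_mult)
  then show ?thesis using assms(3) by (simp add: real_sqrt_mult)
qed

lemma norm_sq_le_if_norm_le:
  assumes "sqrt (enn2real a) \<le> k * sqrt (enn2real b)" "a < \<infinity>" "b < \<infinity>"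
  shows "a \<le> ennreal (k\<^sup>2) * b"
proof -
  obtain x y where xy: "a = ennreal x" "0 \<le> x" "b = ennreal y" "0 \<le> y"
    using assms(2,3) by (metis ennreal_cases infinity_ennreal_def less_irrefl)
  have "x = (sqrt x)\<^sup>2" using xy by simp
  also have "\<dots> \<le> (k * sqrt y)\<^sup>2" using assms(1) xy by (intro power_mono) auto
  also have "\<dots> = k\<^sup>2 * y" using xy by (simp add: power_mult_distrib)
  finally show ?thesis using xy by (simp add: ennreal_mult'[symmetric] ennreal_leI)
qed

text \<open>Completeness of Lebesgue measure: preimages under \<open>f\<close> and \<open>g\<close>
  differ by a subset of a null set.\<close>

lemma borel_measurable_lebesgue_AE_cong:
  fixes f g :: "'b::euclidean_space \<Rightarrow> 'c::topological_space"
  assumes g: "g \<in> borel_measurable lebesgue" and fg: "AE x in lebesgue. f x = g x"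
  shows "f \<in> borel_measurable lebesgue"
proof (rule measurableI)
  fix A :: "'c set" assume "A \<in> sets borel"
  with g have "g -` A \<in> sets lebesgue" using measurable_sets[of g lebesgue borel A] by simp
  then have "f -` A \<in> sets lebesgue"
    by (rule completion.in_sets_AE[rotated]) (use fg in \<open>auto elim!: eventually_mono\<close>)
  then show "f -` A \<inter> space lebesgue \<in> sets lebesgue" by simp
qed simp

text \<open>Composing a Lebesgue measurable function with a projection is delicate, since preimages
  of Borel sets need not be Borel. A Borel representative of \<open>\<delta>\<close> gives a Borel
  weight, and the change happens on a null set times the line.\<close>

lemma borel_measurable_cylinder_weight:
  fixes \<Omega> :: "'a::euclidean_space set"
  assumes \<Omega>: "open \<Omega>" and \<delta>: "\<delta> \<in> borel_measurable (lebesgue_on \<Omega>)"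
  shows "(\<lambda>z. snd z powr \<delta> (fst z)) \<in> borel_measurable (lebesgue_on (cylinder \<Omega>))"
proof -
  let ?D = "cylinder \<Omega>"
  have L: "\<Omega> \<in> sets lebesgue" "?D \<in> sets lebesgue"
    using \<Omega> open_cylinder[OF \<Omega>] by (auto intro: sets_completionI_sets)
  have "(\<lambda>x. if x \<in> \<Omega> then \<delta> x else 0) \<in> borel_measurable lebesgue"
    using \<delta> L(1) by (rule borel_measurable_if_I)
  then obtain \<delta>' where \<delta>' [measurable]: "\<delta>' \<in> borel_measurable borel"
    and ae: "AE x in lborel. (if x \<in> \<Omega> then \<delta> x else 0) = \<delta>' x"
    using completion_ex_borel_measurable_real[of "\<lambda>x. if x \<in> \<Omega> then \<delta> x else 0" lborel] by auto
  have [measurable]: "(fst :: 'a \<times> real \<Rightarrow> 'a) \<in> measurable borel borel" "(snd :: 'a \<times> real \<Rightarrow> real) \<in> measurable borel borel"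
    by (intro borel_measurable_continuous_onI continuous_intros)+
  have "(\<lambda>z. snd z powr \<delta>' (fst z)) \<in> borel_measurable (borel :: ('a \<times> real) measure)"
    by measurable
  then have "(\<lambda>z. snd z powr \<delta>' (fst z)) \<in> borel_measurable (lebesgue :: ('a \<times> real) measure)"
    by (intro measurable_completion) simp
  moreover have "AE z in lebesgue. snd z powr (if fst z \<in> \<Omega> then \<delta> (fst z) else 0) = snd z powr \<delta>' (fst (z :: 'a \<times> real))"
    using AE_completion[OF AE_lborel_fst[OF ae]] by eventually_elim simp
  ultimately have "(\<lambda>z::'a \<times> real. snd z powr (if fst z \<in> \<Omega> then \<delta> (fst z) else 0)) \<in> borel_measurable lebesgue"
    by (rule borel_measurable_lebesgue_AE_cong)
  then have "(\<lambda>z::'a \<times> real. snd z powr (if fst z \<in> \<Omega> then \<delta> (fst z) else 0)) \<in> borel_measurable (lebesgue_on ?D)"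
    by (rule measurable_restrict_space1)
  then show ?thesis
    by (rule measurable_cong[THEN iffD1, rotated]) (auto simp: cylinder_def)
qed

lemma has_weak_gradient_borel_measurable:
  assumes "open D" "has_weak_gradient D u g"
  shows "u \<in> borel_measurable (lebesgue_on D)" "g \<in> borel_measurable (lebesgue_on D)"
  using assms by (auto simp: has_weak_gradient_def intro: locally_integrable_on_borel_measurable)

lemma power2_norm_add_le: "(norm (a + b))\<^sup>2 \<le> 2 * (norm a)\<^sup>2 + 2 * (norm (b :: 'b::real_normed_vector))\<^sup>2"
proof -
  have "(norm (a + b))\<^sup>2 \<le> (norm a + norm b)\<^sup>2" by (intro power_mono norm_triangle_ineq) simp
  then show ?thesis using sum_squares_bound[of "norm a" "norm b"] by (simp add: power2_sum)
qed

section \<open>Squared norms on the cylinder with values in [0, infinity]\<close>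

locale degenerate_cylinder =
  fixes \<Omega> :: "'a::euclidean_space set" and s :: "'a \<Rightarrow> real"
  assumes open_base: "open \<Omega>"
    and s_measurable: "s \<in> borel_measurable (lebesgue_on \<Omega>)"
    and s_range: "AE x in lebesgue_on \<Omega>. 0 \<le> s x \<and> s x \<le> 1"
    and s_null: "{x \<in> \<Omega>. s x = 0} \<in> null_sets lebesgue"
begin

abbreviation "\<delta> \<equiv> \<lambda>x. 1 - 2 * s x"
abbreviation "\<rho> \<equiv> \<lambda>x. (1 - \<delta> x)\<^sup>2"
abbreviation "D \<equiv> cylinder \<Omega>"
abbreviation "Hsq \<equiv> H_norm_sq \<Omega> \<delta>"
abbreviation "Lsq \<equiv> L2w_norm_sq \<Omega> \<rho>"
abbreviation "weakly_diff u \<equiv> \<exists>g. has_weak_gradient D u g"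

lemmas open_D = open_cylinder[OF open_base]

lemma weight_measurable: "(\<lambda>z. snd z powr \<delta> (fst z)) \<in> borel_measurable (lebesgue_on D)"
  using s_measurable by (intro borel_measurable_cylinder_weight[OF open_base]) measurable

text \<open>\<open>W_space\<close> asks for two finite integrals; this splitting turns them into the
  single condition \<open>Hsq u < \<infinity>\<close>.\<close>

lemma H_norm_sq_split:
  assumes g: "has_weak_gradient D u g"
  shows "Hsq u = (\<integral>\<^sup>+z. ennreal (snd z powr \<delta> (fst z) * \<bar>u z\<bar>\<^sup>2) \<partial>lebesgue_on D)
    + (\<integral>\<^sup>+z. ennreal (snd z powr \<delta> (fst z) * (norm (g z))\<^sup>2) \<partial>lebesgue_on D)"
proof -
  note [measurable] = weight_measurable has_weak_gradient_borel_measurable[OF open_D g]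
  have "Hsq u = (\<integral>\<^sup>+z. ennreal (snd z powr \<delta> (fst z) * \<bar>u z\<bar>\<^sup>2)
      + ennreal (snd z powr \<delta> (fst z) * (norm (g z))\<^sup>2) \<partial>lebesgue_on D)"
    unfolding H_norm_sq_eq[OF open_base g] by (intro nn_integral_cong) (simp add: distrib_left)
  then show ?thesis by (simp add: nn_integral_add)
qed

lemma H_norm_sq_add:
  assumes "weakly_diff u" "weakly_diff v"
  shows "Hsq (\<lambda>z. u z + v z) \<le> 2 * Hsq u + 2 * Hsq v"
proof -
  obtain g h where g: "has_weak_gradient D u g" and h: "has_weak_gradient D v h" using assms by auto
  note [measurable] = weight_measurable has_weak_gradient_borel_measurable[OF open_D g]
    has_weak_gradient_borel_measurable[OF open_D h]
  let ?w = "\<lambda>z. snd z powr \<delta> (fst z)"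
  have "Hsq (\<lambda>z. u z + v z) = (\<integral>\<^sup>+z. ennreal (?w z * (\<bar>u z + v z\<bar>\<^sup>2 + (norm (g z + h z))\<^sup>2)) \<partial>lebesgue_on D)"
    by (rule H_norm_sq_eq[OF open_base has_weak_gradient_add[OF open_D g h]])
  also have "\<dots> \<le> (\<integral>\<^sup>+z. 2 * ennreal (?w z * (\<bar>u z\<bar>\<^sup>2 + (norm (g z))\<^sup>2))
      + 2 * ennreal (?w z * (\<bar>v z\<bar>\<^sup>2 + (norm (h z))\<^sup>2)) \<partial>lebesgue_on D)"
  proof (rule nn_integral_mono)
    fix z
    have "?w z * (\<bar>u z + v z\<bar>\<^sup>2 + (norm (g z + h z))\<^sup>2)
      \<le> ?w z * ((2 * \<bar>u z\<bar>\<^sup>2 + 2 * \<bar>v z\<bar>\<^sup>2) + (2 * (norm (g z))\<^sup>2 + 2 * (norm (h z))\<^sup>2))"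
      using power2_norm_add_le[of "u z" "v z"] power2_norm_add_le[of "g z" "h z"]
      by (intro mult_left_mono add_mono) auto
    also have "\<dots> = 2 * (?w z * (\<bar>u z\<bar>\<^sup>2 + (norm (g z))\<^sup>2)) + 2 * (?w z * (\<bar>v z\<bar>\<^sup>2 + (norm (h z))\<^sup>2))"
      by (simp add: algebra_simps)
    finally have "ennreal (?w z * (\<bar>u z + v z\<bar>\<^sup>2 + (norm (g z + h z))\<^sup>2))
      \<le> ennreal (2 * (?w z * (\<bar>u z\<bar>\<^sup>2 + (norm (g z))\<^sup>2)) + 2 * (?w z * (\<bar>v z\<bar>\<^sup>2 + (norm (h z))\<^sup>2)))"
      by (rule ennreal_leI)
    then show "ennreal (?w z * (\<bar>u z + v z\<bar>\<^sup>2 + (norm (g z + h z))\<^sup>2))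
      \<le> 2 * ennreal (?w z * (\<bar>u z\<bar>\<^sup>2 + (norm (g z))\<^sup>2)) + 2 * ennreal (?w z * (\<bar>v z\<bar>\<^sup>2 + (norm (h z))\<^sup>2))"
      by (simp add: ennreal_plus ennreal_mult')
  qed
  also have "\<dots> = 2 * Hsq u + 2 * Hsq v"
    unfolding H_norm_sq_eq[OF open_base g] H_norm_sq_eq[OF open_base h]
    by (simp add: nn_integral_add nn_integral_cmult)
  finally show ?thesis .
qed

lemma H_norm_sq_mult:
  assumes "weakly_diff u"
  shows "Hsq (\<lambda>z. c * u z) = ennreal (c\<^sup>2) * Hsq u"
proof -
  obtain g where g: "has_weak_gradient D u g" using assms by auto
  note [measurable] = weight_measurable has_weak_gradient_borel_measurable[OF open_D g]
  show ?thesis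
    unfolding H_norm_sq_eq[OF open_base has_weak_gradient_mult[OF g]] H_norm_sq_eq[OF open_base g]
    by (subst nn_integral_cmult[symmetric])
       (auto intro!: nn_integral_cong simp: ennreal_mult'[symmetric] abs_mult power_mult_distrib algebra_simps)
qed

lemma weakly_diff_add: "weakly_diff u \<Longrightarrow> weakly_diff v \<Longrightarrow> weakly_diff (\<lambda>z. u z + v z)"
  using has_weak_gradient_add[OF open_D] by blast

lemma weakly_diff_mult: "weakly_diff u \<Longrightarrow> weakly_diff (\<lambda>z. c * u z)"
  using has_weak_gradient_mult by blast

lemma weakly_diff_diff: "weakly_diff u \<Longrightarrow> weakly_diff v \<Longrightarrow> weakly_diff (\<lambda>z. u z - v z)"
  using has_weak_gradient_diff[OF open_D] by blast

lemma weakly_diff_smooth: "v \<in> smooth_cylinder \<Omega> \<Longrightarrow> weakly_diff v"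
  using smooth_cylinder_has_weak_gradient[OF open_base] by blast

lemma H_norm_sq_diff:
  assumes "weakly_diff u" "weakly_diff v"
  shows "Hsq (\<lambda>z. u z - v z) \<le> 2 * Hsq u + 2 * Hsq v"
  using H_norm_sq_add[OF assms(1) weakly_diff_mult[OF assms(2)], of "-1"]
    H_norm_sq_mult[OF assms(2), of "-1"] by simp

lemma W_space_iff: "u \<in> W_space \<Omega> \<delta> \<longleftrightarrow> weakly_diff u \<and> Hsq u < \<infinity>"
proof -
  have "Hsq u < \<infinity> \<longleftrightarrow>
      (\<integral>\<^sup>+z. ennreal (snd z powr \<delta> (fst z) * \<bar>u z\<bar>\<^sup>2) \<partial>lebesgue_on D) < \<infinity> \<and>
      (\<integral>\<^sup>+z. ennreal (snd z powr \<delta> (fst z) * (norm (weak_gradient D u z))\<^sup>2) \<partial>lebesgue_on D) < \<infinity>"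
    if "has_weak_gradient D u g" for g
    unfolding H_norm_sq_split[OF weak_gradient[OF that]] by simp
  then show ?thesis unfolding W_space_def by auto
qed

lemma H_norm_less_iff:
  assumes "Hsq u < \<infinity>" "e > 0"
  shows "H_norm \<Omega> \<delta> u < e \<longleftrightarrow> Hsq u < ennreal (e\<^sup>2)"
proof -
  obtain r where r: "Hsq u = ennreal r" "0 \<le> r" using assms(1) by (cases "Hsq u" rule: ennreal_cases) auto
  have "sqrt r < e \<longleftrightarrow> r < e\<^sup>2"
    using assms(2) by (metis abs_of_pos real_sqrt_abs real_sqrt_less_iff)
  then show ?thesis using r by (simp add: H_norm_def ennreal_less_iff)
qed

text \<open>The definition measures distance by \<open>H_norm\<close>, which would be 0 for a
  difference of infinite norm. Both members have finite norm, so the difference has, and distances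
  can be expressed by \<open>Hsq\<close> with the square of the radius absorbed into
  \<open>e\<close>.\<close>

lemma H_closure_iff:
  assumes S: "S \<subseteq> smooth_cylinder \<Omega>"
  shows "u \<in> H_closure \<Omega> \<delta> S \<longleftrightarrow> weakly_diff u \<and> Hsq u < \<infinity> \<and>
    (\<forall>e>0. \<exists>v\<in>S. Hsq v < \<infinity> \<and> Hsq (\<lambda>z. u z - v z) < ennreal e)"
proof (cases "weakly_diff u \<and> Hsq u < \<infinity>")
  case True
  have fin: "Hsq (\<lambda>z. u z - v z) < \<infinity>" if "v \<in> S" "Hsq v < \<infinity>" for v
  proof -
    have "weakly_diff v" using that(1) S weakly_diff_smooth by blast
    then have "Hsq (\<lambda>z. u z - v z) \<le> 2 * Hsq u + 2 * Hsq v"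
      using True by (intro H_norm_sq_diff) auto
    also have "\<dots> < \<infinity>" using True that(2) by (simp add: ennreal_mult_less_top)
    finally show ?thesis .
  qed
  have "(\<forall>\<epsilon>>0. \<exists>v\<in>S. Hsq v < \<infinity> \<and> H_norm \<Omega> \<delta> (\<lambda>z. u z - v z) < \<epsilon>)
    \<longleftrightarrow> (\<forall>\<epsilon>>0. \<exists>v\<in>S. Hsq v < \<infinity> \<and> Hsq (\<lambda>z. u z - v z) < ennreal (\<epsilon>\<^sup>2))"
    using fin H_norm_less_iff by (meson order_less_le_trans)
  also have "\<dots> \<longleftrightarrow> (\<forall>e>0. \<exists>v\<in>S. Hsq v < \<infinity> \<and> Hsq (\<lambda>z. u z - v z) < ennreal e)"
  proof (intro iffI allI impI)
    fix e :: real assume *: "\<forall>\<epsilon>>0. \<exists>v\<in>S. Hsq v < \<infinity> \<and> Hsq (\<lambda>z. u z - v z) < ennreal (\<epsilon>\<^sup>2)" and e: "e > 0"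
    then show "\<exists>v\<in>S. Hsq v < \<infinity> \<and> Hsq (\<lambda>z. u z - v z) < ennreal e"
      using *[rule_format, of "sqrt e"] by simp
  qed simp
  finally show ?thesis using True by (simp add: H_closure_def W_space_iff)
qed (auto simp: H_closure_def W_space_iff)

section \<open>The weighted square-integrable functions on the base\<close>

lemma rho_measurable: "\<rho> \<in> borel_measurable (lebesgue_on \<Omega>)"
  using s_measurable by measurable

text \<open>\<open>1 - \<delta> x\<close> equals \<open>2 * s x\<close>, so the weight vanishes
  exactly where \<open>s\<close> does. Its positivity lets weighted estimates give pointwise
  information, both for convergence of base values and for uniqueness.\<close>

lemma rho_pos: "AE x in lebesgue_on \<Omega>. 0 < \<rho> x"
proof -
  have L: "\<Omega> \<in> sets lebesgue" using open_base by (intro sets_completionI_sets) simp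
  have "AE x in lebesgue. x \<notin> {x \<in> \<Omega>. s x = 0}" using s_null by (rule AE_not_in)
  then have "AE x in lebesgue_on \<Omega>. s x \<noteq> 0"
    using L by (auto simp: AE_restrict_space_iff elim: eventually_mono)
  then show ?thesis by eventually_elim simp
qed

lemma L2w_norm_sq_add:
  assumes "f \<in> borel_measurable (lebesgue_on \<Omega>)" "g \<in> borel_measurable (lebesgue_on \<Omega>)"
  shows "Lsq (\<lambda>x. f x + g x) \<le> 2 * Lsq f + 2 * Lsq g"
proof -
  note [measurable] = assms rho_measurable
  have "Lsq (\<lambda>x. f x + g x) \<le> (\<integral>\<^sup>+x. 2 * ennreal (\<bar>f x\<bar>\<^sup>2 * \<rho> x) + 2 * ennreal (\<bar>g x\<bar>\<^sup>2 * \<rho> x) \<partial>lebesgue_on \<Omega>)"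
    unfolding L2w_norm_sq_def
  proof (rule nn_integral_mono)
    fix x
    have "\<bar>f x + g x\<bar>\<^sup>2 * \<rho> x \<le> (2 * \<bar>f x\<bar>\<^sup>2 + 2 * \<bar>g x\<bar>\<^sup>2) * \<rho> x"
      using power2_norm_add_le[of "f x" "g x"] by (intro mult_right_mono) auto
    then have "ennreal (\<bar>f x + g x\<bar>\<^sup>2 * \<rho> x) \<le> ennreal (2 * (\<bar>f x\<bar>\<^sup>2 * \<rho> x) + 2 * (\<bar>g x\<bar>\<^sup>2 * \<rho> x))"
      by (intro ennreal_leI) (simp only: distrib_right mult.assoc)
    also have "\<dots> = 2 * ennreal (\<bar>f x\<bar>\<^sup>2 * \<rho> x) + 2 * ennreal (\<bar>g x\<bar>\<^sup>2 * \<rho> x)"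
      by (rule ennreal_double_sum) (intro mult_nonneg_nonneg zero_le_power2)+
    finally show "ennreal (\<bar>f x + g x\<bar>\<^sup>2 * \<rho> x) \<le> 2 * ennreal (\<bar>f x\<bar>\<^sup>2 * \<rho> x) + 2 * ennreal (\<bar>g x\<bar>\<^sup>2 * \<rho> x)" .
  qed
  also have "\<dots> = (\<integral>\<^sup>+x. 2 * ennreal (\<bar>f x\<bar>\<^sup>2 * \<rho> x) \<partial>lebesgue_on \<Omega>)
      + (\<integral>\<^sup>+x. 2 * ennreal (\<bar>g x\<bar>\<^sup>2 * \<rho> x) \<partial>lebesgue_on \<Omega>)"
    by (rule nn_integral_add) measurable
  also have "\<dots> = 2 * Lsq f + 2 * Lsq g"
    unfolding L2w_norm_sq_def by (intro arg_cong2[where f = "(+)"] nn_integral_cmult) measurable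
  finally show ?thesis .
qed

lemma L2w_norm_sq_mult:
  assumes "f \<in> borel_measurable (lebesgue_on \<Omega>)"
  shows "Lsq (\<lambda>x. c * f x) = ennreal (c\<^sup>2) * Lsq f"
proof -
  note [measurable] = assms rho_measurable
  show ?thesis
    unfolding L2w_norm_sq_def
    by (subst nn_integral_cmult[symmetric], measurable)
       (auto intro!: nn_integral_cong simp: ennreal_mult'[symmetric] abs_mult power_mult_distrib mult.assoc)
qed

lemma L2w_norm_sq_eq_0:
  assumes "f \<in> borel_measurable (lebesgue_on \<Omega>)" "Lsq f = 0"
  shows "AE x in lebesgue_on \<Omega>. f x = 0"
proof -
  note [measurable] = assms(1) rho_measurable
  have "AE x in lebesgue_on \<Omega>. ennreal (\<bar>f x\<bar>\<^sup>2 * \<rho> x) = 0"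
    by (rule nn_integral_0_iff_AE[THEN iffD1])
       (measurable, use assms(2) in \<open>simp only: L2w_norm_sq_def\<close>)
  with rho_pos show ?thesis
  proof eventually_elim
    case (elim x)
    have "\<bar>f x\<bar>\<^sup>2 * \<rho> x \<le> 0" using elim(2) by (simp only: ennreal_eq_0_iff)
    then have "\<bar>f x\<bar>\<^sup>2 \<le> 0" using elim(1) by (metis mult_le_0_iff not_le zero_le_power2 order_antisym)
    then show ?case by simp
  qed
qed

section \<open>Traces as limits of base values\<close>

abbreviation base_values :: "('a \<times> real \<Rightarrow> real) \<Rightarrow> 'a \<Rightarrow> real" where
  "base_values v \<equiv> \<lambda>x. v (x, 0)"

lemma base_values_measurable:
  assumes "v \<in> smooth_cylinder \<Omega>"
  shows "base_values v \<in> borel_measurable (lebesgue_on \<Omega>)"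
proof -
  have "continuous_on (closure D) v"
    using smooth_cylinder_Ck_up_to[OF assms, of 0] by simp
  moreover have "(\<lambda>x. (x, 0)) ` \<Omega> \<subseteq> closure D"
    using closure_subset[of \<Omega>] by (auto simp: closure_cylinder)
  ultimately have "continuous_on \<Omega> (base_values v)"
    by (auto intro!: continuous_on_compose2[of "closure D" v] continuous_intros)
  then show ?thesis
    using open_base by (intro continuous_imp_measurable_on_sets_lebesgue sets_completionI_sets) auto
qed

text \<open>One factor 4 comes from \<open>\<rho> x = 4 * (s x)\<^sup>2\<close>, the other from
  \<open>trace_inequality\<close>.\<close>

lemma trace_bound_smooth:
  assumes "v \<in> smooth_cylinder \<Omega>"
  shows "Lsq (base_values v) \<le> 16 * Hsq v"
proof -
  note [measurable] = s_measurable base_values_measurable[OF assms]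
  have "Lsq (base_values v) = (\<integral>\<^sup>+x. 4 * ennreal (\<bar>v (x, 0)\<bar>\<^sup>2 * (s x)\<^sup>2) \<partial>lebesgue_on \<Omega>)"
    unfolding L2w_norm_sq_def
    by (intro nn_integral_cong) (simp add: ennreal_mult'[symmetric] power2_eq_square algebra_simps flip: ennreal_numeral)
  also have "\<dots> = 4 * (\<integral>\<^sup>+x. ennreal (\<bar>v (x, 0)\<bar>\<^sup>2 * (s x)\<^sup>2) \<partial>lebesgue_on \<Omega>)"
    by (rule nn_integral_cmult) measurable
  also have "\<dots> \<le> 4 * (4 * Hsq v)"
    by (intro mult_left_mono trace_inequality[OF open_base s_measurable s_range assms]) simp
  finally show ?thesis by (simp add: mult.assoc[symmetric])
qed

text \<open>The approximants range over all smooth functions up to the boundary, also for \<open>H0\<close>: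
  traces on \<open>H0\<close> are then restrictions of those on \<open>H\<close>.\<close>
definition is_trace :: "('a \<times> real \<Rightarrow> real) \<Rightarrow> ('a \<Rightarrow> real) \<Rightarrow> bool" where
  "is_trace u g \<longleftrightarrow> g \<in> borel_measurable (lebesgue_on \<Omega>) \<and>
    (\<forall>e>0. \<exists>v\<in>smooth_cylinder \<Omega>. Hsq (\<lambda>z. u z - v z) \<le> ennreal e \<and>
      Lsq (\<lambda>x. g x - v (x, 0)) \<le> ennreal e)"

lemma is_traceE:
  assumes "is_trace u g" "e > 0"
  obtains v where "v \<in> smooth_cylinder \<Omega>" "Hsq (\<lambda>z. u z - v z) \<le> ennreal e"
    "Lsq (\<lambda>x. g x - v (x, 0)) \<le> ennreal e"
  using assms by (auto simp: is_trace_def)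

lemma is_trace_measurable: "is_trace u g \<Longrightarrow> g \<in> borel_measurable (lebesgue_on \<Omega>)"
  by (simp add: is_trace_def)

lemma is_trace_smooth: "v \<in> smooth_cylinder \<Omega> \<Longrightarrow> is_trace v (base_values v)"
  using base_values_measurable H_norm_sq_mult[OF weakly_diff_smooth, of v 0] L2w_norm_sq_mult[of "base_values v" 0]
  by (auto simp: is_trace_def intro!: bexI[of _ v])

lemma is_trace_add:
  assumes u: "weakly_diff u" "is_trace u f" and v: "weakly_diff v" "is_trace v g"
  shows "is_trace (\<lambda>z. u z + v z) (\<lambda>x. f x + g x)"
  unfolding is_trace_def
proof (intro conjI allI impI)
  note [measurable] = is_trace_measurable[OF u(2)] is_trace_measurable[OF v(2)]
  show "(\<lambda>x. f x + g x) \<in> borel_measurable (lebesgue_on \<Omega>)" by measurable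
  fix e :: real assume e: "e > 0"
  \<comment> \<open>Each of the two errors is doubled by the inequality for squares of sums, so a
    quarter of \<open>e\<close> for each adds up to \<open>e\<close>.\<close>
  then have e4: "e / 4 > 0" by simp
  obtain p where p: "p \<in> smooth_cylinder \<Omega>" "Hsq (\<lambda>z. u z - p z) \<le> ennreal (e / 4)"
    "Lsq (\<lambda>x. f x - p (x, 0)) \<le> ennreal (e / 4)"
    using is_traceE[OF u(2) e4] .
  obtain q where q: "q \<in> smooth_cylinder \<Omega>" "Hsq (\<lambda>z. v z - q z) \<le> ennreal (e / 4)"
    "Lsq (\<lambda>x. g x - q (x, 0)) \<le> ennreal (e / 4)"
    using is_traceE[OF v(2) e4] .
  note [measurable] = base_values_measurable[OF p(1)] base_values_measurable[OF q(1)]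
  have bound: "x \<le> ennreal e" if "x \<le> 2 * y + 2 * z" "y \<le> ennreal (e / 4)" "z \<le> ennreal (e / 4)" for x y z
  proof -
    have "x \<le> 2 * ennreal (e / 4) + 2 * ennreal (e / 4)"
      using that by (meson add_mono mult_left_mono order_trans zero_le)
    also have "\<dots> = ennreal e"
      using e by (simp add: ennreal_mult'[symmetric] ennreal_plus[symmetric] del: ennreal_plus flip: ennreal_numeral)
    finally show ?thesis .
  qed
  have "Hsq (\<lambda>z. (u z + v z) - (p z + q z)) \<le> ennreal e"
    unfolding add_diff_add
    by (rule bound[OF H_norm_sq_add p(2) q(2)]; intro weakly_diff_diff u(1) v(1) weakly_diff_smooth p(1) q(1))
  moreover have "Lsq (\<lambda>x. (f x + g x) - (p (x, 0) + q (x, 0))) \<le> ennreal e"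
    unfolding add_diff_add by (rule bound[OF L2w_norm_sq_add p(3) q(3)]) measurable
  ultimately show "\<exists>w\<in>smooth_cylinder \<Omega>. Hsq (\<lambda>z. u z + v z - w z) \<le> ennreal e \<and>
      Lsq (\<lambda>x. f x + g x - w (x, 0)) \<le> ennreal e"
    using smooth_cylinder_add[OF p(1) q(1)] by (intro bexI[of _ "\<lambda>z. p z + q z"]) auto
qed

lemma is_trace_mult:
  assumes u: "weakly_diff u" "is_trace u f"
  shows "is_trace (\<lambda>z. c * u z) (\<lambda>x. c * f x)"
  unfolding is_trace_def
proof (intro conjI allI impI)
  note [measurable] = is_trace_measurable[OF u(2)]
  show "(\<lambda>x. c * f x) \<in> borel_measurable (lebesgue_on \<Omega>)" by measurable
  fix e :: real assume e: "e > 0"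
  \<comment> \<open>The summand 1 in the denominator covers \<open>c = 0\<close> as well.\<close>
  then have ec: "e / (c\<^sup>2 + 1) > 0" by (simp add: add_nonneg_pos)
  obtain p where p: "p \<in> smooth_cylinder \<Omega>" "Hsq (\<lambda>z. u z - p z) \<le> ennreal (e / (c\<^sup>2 + 1))"
    "Lsq (\<lambda>x. f x - p (x, 0)) \<le> ennreal (e / (c\<^sup>2 + 1))"
    using is_traceE[OF u(2) ec] .
  note [measurable] = base_values_measurable[OF p(1)]
  have pos: "c\<^sup>2 + 1 > 0" by (intro add_nonneg_pos) auto
  have "c\<^sup>2 * (e / (c\<^sup>2 + 1)) \<le> (c\<^sup>2 + 1) * (e / (c\<^sup>2 + 1))"
    using ec by (intro mult_right_mono) auto
  also have "\<dots> = e" using pos by simp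
  finally have le: "c\<^sup>2 * (e / (c\<^sup>2 + 1)) \<le> e" .
  have bound: "ennreal (c\<^sup>2) * y \<le> ennreal e" if "y \<le> ennreal (e / (c\<^sup>2 + 1))" for y
  proof -
    have "ennreal (c\<^sup>2) * y \<le> ennreal (c\<^sup>2) * ennreal (e / (c\<^sup>2 + 1))"
      using that by (rule mult_left_mono) simp
    also have "\<dots> \<le> ennreal e" using le by (simp add: ennreal_mult'[symmetric] ennreal_leI)
    finally show ?thesis .
  qed
  have "Hsq (\<lambda>z. c * u z - c * p z) \<le> ennreal e"
    using H_norm_sq_mult[OF weakly_diff_diff[OF u(1) weakly_diff_smooth[OF p(1)]], of c] bound[OF p(2)]
    by (simp add: right_diff_distrib)
  moreover have "Lsq (\<lambda>x. c * f x - c * p (x, 0)) \<le> ennreal e"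
    using L2w_norm_sq_mult[of "\<lambda>x. f x - p (x, 0)" c] bound[OF p(3)]
    by (simp add: right_diff_distrib)
  ultimately show "\<exists>w\<in>smooth_cylinder \<Omega>. Hsq (\<lambda>z. c * u z - w z) \<le> ennreal e \<and>
      Lsq (\<lambda>x. c * f x - w (x, 0)) \<le> ennreal e"
    using smooth_cylinder_mult[OF p(1), of c] by (intro bexI[of _ "\<lambda>z. c * p z"]) auto
qed

text \<open>Split \<open>g\<close> into the error \<open>g - v\<close> and the base values of an
  approximant \<open>v\<close>, and bound \<open>Hsq v\<close> by \<open>Hsq u\<close> and the
  error. The constant is 64 = 2 * 16 * 2.\<close>

lemma is_trace_bound:
  assumes u: "weakly_diff u" "is_trace u g"
  shows "Lsq g \<le> 64 * Hsq u"
proof (rule ennreal_le_epsilon)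
  fix e :: real assume e: "0 < e"
  \<comment> \<open>The error terms enter with total factor 2 + 2 * 16 * 2 = 66.\<close>
  then have e': "e / 66 > 0" by simp
  obtain v where v: "v \<in> smooth_cylinder \<Omega>" "Hsq (\<lambda>z. u z - v z) \<le> ennreal (e / 66)"
    "Lsq (\<lambda>x. g x - v (x, 0)) \<le> ennreal (e / 66)"
    using is_traceE[OF u(2) e'] .
  note [measurable] = is_trace_measurable[OF u(2)] base_values_measurable[OF v(1)]
  have v': "weakly_diff v" by (rule weakly_diff_smooth[OF v(1)])
  have "Lsq g = Lsq (\<lambda>x. (g x - v (x, 0)) + v (x, 0))" by simp
  also have "\<dots> \<le> 2 * Lsq (\<lambda>x. g x - v (x, 0)) + 2 * Lsq (base_values v)"
    by (rule L2w_norm_sq_add) measurable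
  also have "\<dots> \<le> 2 * ennreal (e / 66) + 2 * (16 * (2 * Hsq u + 2 * ennreal (e / 66)))"
  proof (intro add_mono mult_left_mono v)
    have "Hsq v \<le> 2 * Hsq u + 2 * Hsq (\<lambda>z. u z - v z)"
      using H_norm_sq_diff[OF u(1) weakly_diff_diff[OF u(1) v']] by simp
    also have "\<dots> \<le> 2 * Hsq u + 2 * ennreal (e / 66)"
      by (intro add_mono mult_left_mono v) auto
    finally have "16 * Hsq v \<le> 16 * (2 * Hsq u + 2 * ennreal (e / 66))"
      by (rule mult_left_mono) simp
    then show "Lsq (base_values v) \<le> 16 * (2 * Hsq u + 2 * ennreal (e / 66))"
      using trace_bound_smooth[OF v(1)] by (rule order_trans[rotated])
  qed auto
  also have "\<dots> = 64 * Hsq u + 66 * ennreal (e / 66)"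
    by (simp add: distrib_left mult.assoc[symmetric] add_ac distrib_right[symmetric])
  also have "66 * ennreal (e / 66) = ennreal e"
    using e by (simp add: ennreal_mult'[symmetric] flip: ennreal_numeral)
  finally show "Lsq g \<le> 64 * Hsq u + ennreal e" .
qed

lemma H_norm_sq_AE_eq_0:
  assumes u: "weakly_diff u" and "AE z in lebesgue_on D. u z = 0"
  shows "Hsq u = 0"
proof -
  obtain g where g: "has_weak_gradient D u g" using u by blast
  \<comment> \<open>The zero function is written as a multiple of \<open>u\<close>, so its weak
    gradient comes from the scaling rule and can be compared with \<open>g\<close>.\<close>
  have "has_weak_gradient D (\<lambda>z. 0 * u z) (\<lambda>z. 0 *\<^sub>R g z)" by (rule has_weak_gradient_mult[OF g])
  then have "AE z in lebesgue_on D. g z = 0 *\<^sub>R g z"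
    using assms(2) by (intro has_weak_gradient_unique[OF open_D g]) auto
  with assms(2) have "AE z in lebesgue_on D. ennreal (snd z powr \<delta> (fst z) * (\<bar>u z\<bar>\<^sup>2 + (norm (g z))\<^sup>2)) = 0"
    by eventually_elim simp
  then show ?thesis
    unfolding H_norm_sq_eq[OF open_base g] by (subst nn_integral_cong_AE[where v = "\<lambda>_. 0"]) auto
qed

text \<open>The difference of the two traces is a trace of a function of norm 0, and the bound makes
  it vanish where the weight is positive. Well-definedness on classes, linearity, the correct values
  on smooth functions and uniqueness of the operator are all deduced from this.\<close>

lemma is_trace_unique:
  assumes u: "weakly_diff u" "is_trace u f" and v: "weakly_diff v" "is_trace v g"
    and uv: "AE z in lebesgue_on D. u z = v z"
  shows "AE x in lebesgue_on \<Omega>. f x = g x"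
proof -
  have wd: "weakly_diff (\<lambda>z. u z + - 1 * v z)"
    by (rule weakly_diff_add[OF u(1) weakly_diff_mult[OF v(1)]])
  have tr: "is_trace (\<lambda>z. u z + - 1 * v z) (\<lambda>x. f x + - 1 * g x)"
    by (rule is_trace_add[OF u weakly_diff_mult[OF v(1)] is_trace_mult[OF v]])
  have "Hsq (\<lambda>z. u z + - 1 * v z) = 0"
    using uv by (intro H_norm_sq_AE_eq_0 wd) auto
  then have "Lsq (\<lambda>x. f x + - 1 * g x) = 0"
    using is_trace_bound[OF wd tr] by simp
  then have "AE x in lebesgue_on \<Omega>. f x + - 1 * g x = 0"
    by (rule L2w_norm_sq_eq_0[OF is_trace_measurable[OF tr]])
  then show ?thesis by eventually_elim simp
qed

text \<open>A pointwise limit alone would not be a trace; the estimates between approximants pass to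
  the limit by Fatou's lemma and give convergence of the base values in the weighted norm.\<close>

lemma is_trace_exists:
  assumes u: "weakly_diff u"
    and approx: "\<forall>e>0. \<exists>v\<in>smooth_cylinder \<Omega>. Hsq v < \<infinity> \<and> Hsq (\<lambda>z. u z - v z) < ennreal e"
  shows "\<exists>g. is_trace u g"
proof -
  \<comment> \<open>The rate 1/16 leaves room for a factor \<open>4 ^ n\<close> in the series below:
    the product is (1/4)^n, still summable, while the gained factor forces geometric decay of the
    increments.\<close>
  define q where "q n = (1 / 16 :: real) ^ n" for n
  have q: "0 < q n" for n by (simp add: q_def)
  have q_mono: "q m \<le> q n" if "n \<le> m" for m n
    using that by (auto simp: q_def intro: power_decreasing)
  have "\<forall>n. \<exists>v\<in>smooth_cylinder \<Omega>. Hsq (\<lambda>z. u z - v z) \<le> ennreal (q n)"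
    using approx q less_imp_le by blast
  then obtain v where v: "\<And>n. v n \<in> smooth_cylinder \<Omega>" "\<And>n. Hsq (\<lambda>z. u z - v n z) \<le> ennreal (q n)"
    by metis
  note wv = weakly_diff_smooth[OF v(1)]
  note meas = base_values_measurable[OF v(1)]
  note [measurable] = meas rho_measurable
  \<comment> \<open>Comparison through \<open>u\<close>: the two errors are at most
    \<open>q n\<close> each, and 16 * (2 + 2) = 64.\<close>
  have pair: "Lsq (\<lambda>x. v m (x, 0) - v n (x, 0)) \<le> ennreal (64 * q n)" if "n \<le> m" for m n
  proof -
    have "Lsq (\<lambda>x. v m (x, 0) - v n (x, 0)) \<le> 16 * Hsq (\<lambda>z. v m z - v n z)"
      using trace_bound_smooth[OF smooth_cylinder_diff[OF v(1) v(1)], of m n] .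
    also have "(\<lambda>z. v m z - v n z) = (\<lambda>z. (u z - v n z) - (u z - v m z))" by simp
    also have "16 * Hsq \<dots> \<le> 16 * (2 * Hsq (\<lambda>z. u z - v n z) + 2 * Hsq (\<lambda>z. u z - v m z))"
      by (intro mult_left_mono H_norm_sq_diff weakly_diff_diff u wv) simp
    also have "\<dots> \<le> 16 * (2 * ennreal (q n) + 2 * ennreal (q n))"
      using order_trans[OF v(2)[of m] ennreal_leI[OF q_mono[OF that]]]
      by (intro mult_left_mono add_mono v(2)) auto
    also have "\<dots> = 16 * ennreal (2 * q n + 2 * q n)"
      using q[of n] by (subst ennreal_double_sum) auto
    also have "\<dots> = ennreal (16 * (2 * q n + 2 * q n))" by (simp only: ennreal_mult' ennreal_numeral)
    finally show ?thesis by simp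
  qed
  have conv: "AE x in lebesgue_on \<Omega>. convergent (\<lambda>n. v n (x, 0))"
  proof -
    \<comment> \<open>Weighted squared increments, amplified by \<open>4 ^ n\<close>. The sum of
      their integrals is finite, so almost everywhere the series itself is finite.\<close>
    define t where "t n x = ennreal (4 ^ n) * ennreal (\<bar>v (Suc n) (x, 0) - v n (x, 0)\<bar>\<^sup>2 * \<rho> x)" for n x
    have tm: "t n \<in> borel_measurable (lebesgue_on \<Omega>)" for n
      unfolding t_def by measurable
    have "(\<integral>\<^sup>+x. (\<Sum>n. t n x) \<partial>lebesgue_on \<Omega>) = (\<Sum>n. \<integral>\<^sup>+x. t n x \<partial>lebesgue_on \<Omega>)"
      using tm by (rule nn_integral_suminf)
    also have "\<dots> \<le> (\<Sum>n. ennreal (64 * (1 / 4) ^ n))"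
    proof (rule suminf_le)
      fix n
      have "(\<integral>\<^sup>+x. t n x \<partial>lebesgue_on \<Omega>) = ennreal (4 ^ n) * Lsq (\<lambda>x. v (Suc n) (x, 0) - v n (x, 0))"
        unfolding t_def L2w_norm_sq_def by (rule nn_integral_cmult) measurable
      also have "\<dots> \<le> ennreal (4 ^ n) * ennreal (64 * q n)"
        by (intro mult_left_mono pair) auto
      also have "\<dots> = ennreal (64 * (4 ^ n * q n))"
        by (simp add: ennreal_mult'[symmetric] mult_ac)
      also have "4 ^ n * q n = (1 / 4) ^ n"
        by (simp add: q_def power_mult_distrib[symmetric] del: power_mult_distrib)
      finally show "(\<integral>\<^sup>+x. t n x \<partial>lebesgue_on \<Omega>) \<le> ennreal (64 * (1 / 4) ^ n)" .
    qed (rule summableI)+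
    finally have le: "(\<integral>\<^sup>+x. (\<Sum>n. t n x) \<partial>lebesgue_on \<Omega>) \<le> (\<Sum>n. ennreal (64 * (1 / 4) ^ n))" .
    have "summable (\<lambda>n. 64 * (1 / 4 :: real) ^ n)"
      by (intro summable_mult summable_geometric) simp
    then have "(\<Sum>n. ennreal (64 * (1 / 4) ^ n)) \<noteq> top"
      by (rule ennreal_suminf_neq_top) simp
    with le have "(\<integral>\<^sup>+x. (\<Sum>n. t n x) \<partial>lebesgue_on \<Omega>) \<noteq> \<infinity>"
      by (metis infinity_ennreal_def top_unique)
    then have "AE x in lebesgue_on \<Omega>. (\<Sum>n. t n x) \<noteq> \<infinity>"
      by (rule nn_integral_PInf_AE[rotated]) (use tm in measurable)
    with rho_pos show ?thesis
    proof eventually_elim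
      case (elim x)
      define r where "r = \<rho> x"
      define d where "d n = v (Suc n) (x, 0) - v n (x, 0)" for n
      have r: "r > 0" using elim(1) by (simp only: r_def)
      obtain B where B: "(\<Sum>n. t n x) = ennreal B" "0 \<le> B"
        using elim(2) by (cases "\<Sum>n. t n x" rule: ennreal_cases) auto
      \<comment> \<open>One term of a series of non-negative terms is at most its sum
        \<open>B\<close>; dividing by the positive weight \<open>r\<close> and taking roots turns
        \<open>4 ^ n\<close> into decay of order (1/2)^n, hence absolute summability of the
        increments.\<close>
      have "\<bar>d n\<bar> \<le> sqrt (B / r) * (1 / 2) ^ n" for n
      proof -
        have "t n x \<le> (\<Sum>n. t n x)"
          using sum_le_suminf[OF summableI, of "{n}" "\<lambda>n. t n x"] by simp
        moreover have "t n x = ennreal (4 ^ n * (\<bar>d n\<bar>\<^sup>2 * r))"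
          unfolding t_def d_def r_def by (rule ennreal_mult'[symmetric]) simp
        ultimately have "4 ^ n * (\<bar>d n\<bar>\<^sup>2 * r) \<le> B" using B by simp
        then have "\<bar>d n\<bar>\<^sup>2 \<le> B / r * (1 / 4) ^ n"
          using r by (simp add: field_simps)
        also have "(1 / 4 :: real) ^ n = ((1 / 2) ^ n)\<^sup>2"
          by (simp add: power2_eq_square flip: power_mult_distrib)
        also have "B / r * \<dots> = (sqrt (B / r) * (1 / 2) ^ n)\<^sup>2"
          using B r by (simp only: power_mult_distrib) simp
        finally show ?thesis
          by (rule power2_le_imp_le) (use B r in auto)
      qed
      then have "summable d"
        by (intro summable_comparison_test'[OF summable_mult[OF summable_geometric[of "1 / 2 :: real"]], of 0]) auto
      then have "(\<lambda>n. \<Sum>k<n. d k) \<longlonglongrightarrow> suminf d" by (rule summable_LIMSEQ)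
      then have "(\<lambda>n. (\<Sum>k<n. d k) + v 0 (x, 0)) \<longlonglongrightarrow> suminf d + v 0 (x, 0)"
        by (intro tendsto_add tendsto_const)
      moreover have "(\<Sum>k<n. d k) + v 0 (x, 0) = v n (x, 0)" for n
        unfolding d_def using sum_lessThan_telescope[of "\<lambda>k. v k (x, 0)" n] by simp
      ultimately show ?case by (auto simp: convergent_def)
    qed
  qed
  \<comment> \<open>Where the sequence diverges, which happens on a null set only,
    \<open>lim\<close> has an unspecified value; \<open>g\<close> is measurable all the
    same.\<close>
  define g where "g x = lim (\<lambda>n. v n (x, 0))" for x
  have gm: "g \<in> borel_measurable (lebesgue_on \<Omega>)"
    unfolding g_def using meas by (rule borel_measurable_lim_metric)
  have "Lsq (\<lambda>x. g x - v n (x, 0)) \<le> ennreal (64 * q n)" for n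
  proof -
    have "Lsq (\<lambda>x. g x - v n (x, 0))
        = (\<integral>\<^sup>+x. liminf (\<lambda>m. ennreal (\<bar>v m (x, 0) - v n (x, 0)\<bar>\<^sup>2 * \<rho> x)) \<partial>lebesgue_on \<Omega>)"
      unfolding L2w_norm_sq_def
    proof (rule nn_integral_cong_AE)
      show "AE x in lebesgue_on \<Omega>. ennreal (\<bar>g x - v n (x, 0)\<bar>\<^sup>2 * \<rho> x)
          = liminf (\<lambda>m. ennreal (\<bar>v m (x, 0) - v n (x, 0)\<bar>\<^sup>2 * \<rho> x))"
        using conv
      proof eventually_elim
        case (elim x)
        then have "(\<lambda>m. v m (x, 0)) \<longlonglongrightarrow> g x" unfolding g_def by (simp add: convergent_LIMSEQ_iff)
        then have "(\<lambda>m. ennreal (\<bar>v m (x, 0) - v n (x, 0)\<bar>\<^sup>2 * \<rho> x)) \<longlonglongrightarrow> ennreal (\<bar>g x - v n (x, 0)\<bar>\<^sup>2 * \<rho> x)"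
          by (intro tendsto_intros)
        then show ?case using lim_imp_Liminf by (metis sequentially_bot)
      qed
    qed
    \<comment> \<open>Fatou's lemma in \<open>m\<close> with \<open>n\<close> fixed; the bound for
      pairs holds from \<open>m = n\<close> on.\<close>
    also have "\<dots> \<le> liminf (\<lambda>m. Lsq (\<lambda>x. v m (x, 0) - v n (x, 0)))"
      unfolding L2w_norm_sq_def by (rule nn_integral_liminf) measurable
    also have "\<dots> \<le> ennreal (64 * q n)"
      by (intro Liminf_le eventually_sequentiallyI[of n] pair) auto
    finally show ?thesis .
  qed
  moreover have "\<exists>n. 64 * q n \<le> e" if "e > 0" for e
  proof -
    obtain n where "(1 / 16 :: real) ^ n < e / 64"
      using real_arch_pow_inv[of "e / 64" "1 / 16"] \<open>e > 0\<close> by auto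
    then show ?thesis by (intro exI[of _ n]) (simp add: q_def)
  qed
  ultimately have "\<exists>n. Hsq (\<lambda>z. u z - v n z) \<le> ennreal e \<and> Lsq (\<lambda>x. g x - v n (x, 0)) \<le> ennreal e"
    if "e > 0" for e
  proof -
    obtain n where n: "64 * q n \<le> e" using \<open>e > 0\<close> \<open>\<And>e. e > 0 \<Longrightarrow> \<exists>n. 64 * q n \<le> e\<close> by blast
    have "q n \<le> e" using n q[of n] by simp
    then show ?thesis
      using v(2)[of n] n \<open>Lsq (\<lambda>x. g x - v n (x, 0)) \<le> ennreal (64 * q n)\<close>
      by (intro exI[of _ n] conjI) (auto intro: order_trans ennreal_leI)
  qed
  then have "is_trace u g"
    unfolding is_trace_def using gm v(1) by blast
  then show ?thesis by blast
qed

section \<open>The closures as linear spaces\<close>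

text \<open>Places the approximants in the domain of the operator, so that \<open>T v\<close> is
  governed by the boundary condition in the uniqueness argument.\<close>

lemma H_closure_smooth:
  assumes "S \<subseteq> smooth_cylinder \<Omega>" "v \<in> S" "Hsq v < \<infinity>"
  shows "v \<in> H_closure \<Omega> \<delta> S"
  unfolding H_closure_iff[OF assms(1)]
proof (intro conjI allI impI assms(3))
  show wv: "weakly_diff v" using assms(1,2) weakly_diff_smooth by blast
  fix e :: real assume "e > 0"
  moreover have "Hsq (\<lambda>z. v z - v z) = 0" using H_norm_sq_mult[OF wv, of 0] by simp
  ultimately show "\<exists>w\<in>S. Hsq w < \<infinity> \<and> Hsq (\<lambda>z. v z - w z) < ennreal e"
    using assms(2,3) by (intro bexI[of _ v]) auto
qed

lemma H_closure_add:
  assumes S: "S \<subseteq> smooth_cylinder \<Omega>" and add: "\<And>p q. p \<in> S \<Longrightarrow> q \<in> S \<Longrightarrow> (\<lambda>z. p z + q z) \<in> S"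
    and u: "u \<in> H_closure \<Omega> \<delta> S" and v: "v \<in> H_closure \<Omega> \<delta> S"
  shows "(\<lambda>z. u z + v z) \<in> H_closure \<Omega> \<delta> S"
  unfolding H_closure_iff[OF S]
proof (intro conjI allI impI)
  note u = u[unfolded H_closure_iff[OF S]] and v = v[unfolded H_closure_iff[OF S]]
  have fin: "Hsq (\<lambda>z. p z + q z) < \<infinity>" if "weakly_diff p" "weakly_diff q" "Hsq p < \<infinity>" "Hsq q < \<infinity>" for p q
    using that(3,4) by (intro order.strict_trans1[OF H_norm_sq_add[OF that(1,2)]]) (simp add: ennreal_mult_less_top)
  show "weakly_diff (\<lambda>z. u z + v z)" using u v by (intro weakly_diff_add) auto
  show "Hsq (\<lambda>z. u z + v z) < \<infinity>" using u v by (intro fin) auto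
  fix e :: real assume "e > 0"
  then have e4: "e / 4 > 0" by simp
  obtain p where p: "p \<in> S" "Hsq p < \<infinity>" "Hsq (\<lambda>z. u z - p z) < ennreal (e / 4)" using u e4 by blast
  obtain q where q: "q \<in> S" "Hsq q < \<infinity>" "Hsq (\<lambda>z. v z - q z) < ennreal (e / 4)" using v e4 by blast
  have wd: "weakly_diff p" "weakly_diff q" using S p(1) q(1) weakly_diff_smooth by blast+
  have "Hsq (\<lambda>z. (u z + v z) - (p z + q z)) \<le> 2 * Hsq (\<lambda>z. u z - p z) + 2 * Hsq (\<lambda>z. v z - q z)"
    unfolding add_diff_add using u v wd by (intro H_norm_sq_add weakly_diff_diff) auto
  also have "\<dots> < 2 * ennreal (e / 4) + 2 * ennreal (e / 4)"
    using p(3) q(3) by (intro add_strict_mono ennreal_mult_strict_left_mono) auto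
  also have "\<dots> = ennreal (2 * (e / 4) + 2 * (e / 4))"
    using e4 by (subst ennreal_double_sum) auto
  finally have "Hsq (\<lambda>z. (u z + v z) - (p z + q z)) < ennreal e" by simp
  then show "\<exists>w\<in>S. Hsq w < \<infinity> \<and> Hsq (\<lambda>z. u z + v z - w z) < ennreal e"
    using add[OF p(1) q(1)] fin[OF wd p(2) q(2)] by (intro bexI[of _ "\<lambda>z. p z + q z"]) auto
qed

lemma H_closure_mult:
  assumes S: "S \<subseteq> smooth_cylinder \<Omega>" and mult: "\<And>p. p \<in> S \<Longrightarrow> (\<lambda>z. c * p z) \<in> S"
    and u: "u \<in> H_closure \<Omega> \<delta> S"
  shows "(\<lambda>z. c * u z) \<in> H_closure \<Omega> \<delta> S"
  unfolding H_closure_iff[OF S]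
proof (intro conjI allI impI)
  note u = u[unfolded H_closure_iff[OF S]]
  have fin: "Hsq (\<lambda>z. c * p z) < \<infinity>" if "weakly_diff p" "Hsq p < \<infinity>" for p
    using H_norm_sq_mult[OF that(1), of c] that(2) by (simp add: ennreal_mult_less_top)
  show "weakly_diff (\<lambda>z. c * u z)" using u by (intro weakly_diff_mult) auto
  show "Hsq (\<lambda>z. c * u z) < \<infinity>" using u by (intro fin) auto
  fix e :: real assume e: "e > 0"
  have pos: "c\<^sup>2 + 1 > 0" by (intro add_nonneg_pos) auto
  then have ec: "e / (c\<^sup>2 + 1) > 0" using e by simp
  obtain p where p: "p \<in> S" "Hsq p < \<infinity>" "Hsq (\<lambda>z. u z - p z) < ennreal (e / (c\<^sup>2 + 1))" using u ec by blast
  have wd: "weakly_diff p" using S p(1) weakly_diff_smooth by blast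
  have "Hsq (\<lambda>z. c * u z - c * p z) = ennreal (c\<^sup>2) * Hsq (\<lambda>z. u z - p z)"
    unfolding right_diff_distrib[symmetric] using u wd by (intro H_norm_sq_mult weakly_diff_diff) auto
  also have "\<dots> \<le> ennreal (c\<^sup>2) * ennreal (e / (c\<^sup>2 + 1))"
    using p(3) by (intro mult_left_mono) auto
  also have "\<dots> = ennreal (c\<^sup>2 * (e / (c\<^sup>2 + 1)))" by (rule ennreal_mult'[symmetric]) simp
  \<comment> \<open>The strict inequality demanded by the closure comes from
    \<open>c\<^sup>2 < c\<^sup>2 + 1\<close> and so survives \<open>c = 0\<close>.\<close>
  also have "\<dots> < ennreal ((c\<^sup>2 + 1) * (e / (c\<^sup>2 + 1)))"
    using ec by (intro ennreal_lessI mult_strict_right_mono mult_pos_pos pos) auto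
  also have "(c\<^sup>2 + 1) * (e / (c\<^sup>2 + 1)) = e" using pos by simp
  finally have "Hsq (\<lambda>z. c * u z - c * p z) < ennreal e" .
  then show "\<exists>w\<in>S. Hsq w < \<infinity> \<and> Hsq (\<lambda>z. c * u z - w z) < ennreal e"
    using mult[OF p(1)] fin[OF wd p(2)] by (intro bexI[of _ "\<lambda>z. c * p z"]) auto
qed

section \<open>Existence and uniqueness of the trace operator\<close>

definition trace :: "('a \<times> real \<Rightarrow> real) \<Rightarrow> 'a \<Rightarrow> real" where
  "trace u = (SOME g. is_trace u g)"

lemma is_trace_trace:
  assumes "S \<subseteq> smooth_cylinder \<Omega>" "u \<in> H_closure \<Omega> \<delta> S"
  shows "is_trace u (trace u)"
proof -
  have "\<exists>g. is_trace u g"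
    using assms(2) is_trace_exists[of u] assms(1) unfolding H_closure_iff[OF assms(1)] by (meson subsetD)
  then show ?thesis unfolding trace_def by (rule someI_ex)
qed

text \<open>Uniqueness of the operator: on an approximant \<open>v\<close> the value
  \<open>T v\<close> is prescribed, and \<open>T (u - v)\<close> is small by boundedness, so the
  approximants of \<open>u\<close> also witness \<open>is_trace u (T u)\<close>. Single-valuedness
  of the relation then identifies any two such operators.\<close>

lemma is_trace_trace_operator:
  assumes S: "S \<subseteq> smooth_cylinder \<Omega>"
    and add: "\<And>p q. p \<in> S \<Longrightarrow> q \<in> S \<Longrightarrow> (\<lambda>z. p z + q z) \<in> S"
    and mult: "\<And>p c. p \<in> S \<Longrightarrow> (\<lambda>z. c * p z) \<in> S"
    and T: "trace_operator \<Omega> \<delta> (H_closure \<Omega> \<delta> S) S \<rho> T"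
    and u: "u \<in> H_closure \<Omega> \<delta> S"
  shows "is_trace u (T u)"
  unfolding is_trace_def
proof (intro conjI allI impI)
  let ?X = "H_closure \<Omega> \<delta> S"
  note T = T[unfolded trace_operator_def bounded_linear_ae_def]
  have TX: "T w \<in> borel_measurable (lebesgue_on \<Omega>)" "Lsq (T w) < \<infinity>" if "w \<in> ?X" for w
    using T that by (auto simp: L2w_space_def)
  show "T u \<in> borel_measurable (lebesgue_on \<Omega>)" using TX u by blast
  have T_add: "AE x in lebesgue_on \<Omega>. T (\<lambda>z. p z + q z) x = T p x + T q x"
    if "p \<in> ?X" "q \<in> ?X" for p q
    using T that by simp
  obtain K where K: "\<And>w. w \<in> ?X \<Longrightarrow> L2w_norm \<Omega> \<rho> (T w) \<le> K * H_norm \<Omega> \<delta> w"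
    using T by blast
  fix e :: real assume e: "e > 0"
  have pos: "K\<^sup>2 + 1 > 0" by (intro add_nonneg_pos) auto
  then have eK: "e / (K\<^sup>2 + 1) > 0" using e by simp
  obtain v where v: "v \<in> S" "Hsq v < \<infinity>" "Hsq (\<lambda>z. u z - v z) < ennreal (e / (K\<^sup>2 + 1))"
    using u eK unfolding H_closure_iff[OF S] by blast
  have vX: "v \<in> ?X" using H_closure_smooth[OF S v(1,2)] .
  \<comment> \<open>Subtraction is reached through the closure under sums and multiples. Below,
    additivity of \<open>T\<close> is applied to the sum of \<open>u - v\<close> and
    \<open>v\<close>, which is literally \<open>u\<close>.\<close>
  have "(\<lambda>z. u z + - 1 * v z) \<in> ?X"
    by (rule H_closure_add[OF S add u H_closure_mult[OF S mult vX]])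
  moreover have "(\<lambda>z. u z + - 1 * v z) = (\<lambda>z. u z - v z)" by simp
  ultimately have dX: "(\<lambda>z. u z - v z) \<in> ?X" by (simp only:)
  note [measurable] = TX(1)[OF u] TX(1)[OF vX] TX(1)[OF dX] base_values_measurable[OF subsetD[OF S v(1)]]
  have "AE x in lebesgue_on \<Omega>. T (\<lambda>z. (u z - v z) + v z) x = T (\<lambda>z. u z - v z) x + T v x"
    by (rule T_add[OF dX vX])
  moreover have "AE x in lebesgue_on \<Omega>. T v x = v (x, 0)"
    using T vX v(1) by blast
  ultimately have "AE x in lebesgue_on \<Omega>. T u x - v (x, 0) = T (\<lambda>z. u z - v z) x"
    by eventually_elim simp
  then have "Lsq (\<lambda>x. T u x - v (x, 0)) = Lsq (T (\<lambda>z. u z - v z))"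
    unfolding L2w_norm_sq_def by (intro nn_integral_cong_AE) (auto elim: eventually_mono)
  also have "\<dots> \<le> ennreal (K\<^sup>2) * Hsq (\<lambda>z. u z - v z)"
    using K[OF dX] TX(2)[OF dX] dX unfolding L2w_norm_def H_norm_def H_closure_iff[OF S]
    by (intro norm_sq_le_if_norm_le) auto
  also have "\<dots> \<le> ennreal (K\<^sup>2) * ennreal (e / (K\<^sup>2 + 1))"
    using v(3) by (intro mult_left_mono) auto
  also have "\<dots> = ennreal (K\<^sup>2 * (e / (K\<^sup>2 + 1)))" by (rule ennreal_mult'[symmetric]) simp
  also have "\<dots> \<le> ennreal ((K\<^sup>2 + 1) * (e / (K\<^sup>2 + 1)))"
    using eK by (intro ennreal_leI mult_right_mono) auto
  also have "(K\<^sup>2 + 1) * (e / (K\<^sup>2 + 1)) = e" using pos by simp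
  finally have L: "Lsq (\<lambda>x. T u x - v (x, 0)) \<le> ennreal e" .
  have "1 * (e / (K\<^sup>2 + 1)) \<le> (K\<^sup>2 + 1) * (e / (K\<^sup>2 + 1))"
    using eK by (intro mult_right_mono) auto
  then have "e / (K\<^sup>2 + 1) \<le> e" using pos by simp
  then have "Hsq (\<lambda>z. u z - v z) \<le> ennreal e"
    using v(3) by (meson ennreal_leI less_imp_le order_trans)
  with L v(1) S show "\<exists>v\<in>smooth_cylinder \<Omega>. Hsq (\<lambda>z. u z - v z) \<le> ennreal e \<and>
      Lsq (\<lambda>x. T u x - v (x, 0)) \<le> ennreal e"
    by blast
qed

lemma trace_operator_trace:
  assumes S: "S \<subseteq> smooth_cylinder \<Omega>"
    and add: "\<And>p q. p \<in> S \<Longrightarrow> q \<in> S \<Longrightarrow> (\<lambda>z. p z + q z) \<in> S"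
    and mult: "\<And>p c. p \<in> S \<Longrightarrow> (\<lambda>z. c * p z) \<in> S"
  shows "trace_operator \<Omega> \<delta> (H_closure \<Omega> \<delta> S) S \<rho> trace"
  unfolding trace_operator_def bounded_linear_ae_def
proof (intro conjI ballI allI impI)
  let ?X = "H_closure \<Omega> \<delta> S"
  have X: "weakly_diff u" "Hsq u < \<infinity>" "is_trace u (trace u)" if "u \<in> ?X" for u
    using that is_trace_trace[OF S that] by (auto simp: H_closure_iff[OF S])
  \<comment> \<open>The constant 64 is written as a square, so that the operator bound has constant
    8.\<close>
  have bound: "Lsq (trace u) \<le> ennreal (8\<^sup>2) * Hsq u" if "u \<in> ?X" for u
    using is_trace_bound[OF X(1,3)[OF that]] by simp
  fix u assume u: "u \<in> ?X"
  show "trace u \<in> L2w_space \<Omega> \<rho>"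
  proof -
    have "ennreal (8\<^sup>2) * Hsq u < \<infinity>" using X(2)[OF u] by (simp add: ennreal_mult_less_top)
    then have "Lsq (trace u) < \<infinity>" using bound[OF u] by (rule order.strict_trans1[rotated])
    then show ?thesis using is_trace_measurable[OF X(3)[OF u]] by (simp add: L2w_space_def)
  qed
  show "AE x in lebesgue_on \<Omega>. trace u x = trace v x"
    if "v \<in> ?X" "AE z in lebesgue_on D. u z = v z" for v
    using that X u by (intro is_trace_unique[of u _ v]) auto
  show "AE x in lebesgue_on \<Omega>. trace (\<lambda>z. u z + v z) x = trace u x + trace v x" if v: "v \<in> ?X" for v
  proof -
    have uv: "(\<lambda>z. u z + v z) \<in> ?X" by (rule H_closure_add[OF S add u v])
    show ?thesis
      using is_trace_add[OF X(1,3)[OF u] X(1,3)[OF v]] X(1,3)[OF uv]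
      by (intro is_trace_unique[of "\<lambda>z. u z + v z" _ "\<lambda>z. u z + v z"]) auto
  qed
  show "AE x in lebesgue_on \<Omega>. trace (\<lambda>z. c * u z) x = c * trace u x" for c
  proof -
    have cu: "(\<lambda>z. c * u z) \<in> ?X" by (rule H_closure_mult[OF S mult u])
    show ?thesis
      using is_trace_mult[OF X(1,3)[OF u]] X(1,3)[OF cu]
      by (intro is_trace_unique[of "\<lambda>z. c * u z" _ "\<lambda>z. c * u z"]) auto
  qed
next
  let ?X = "H_closure \<Omega> \<delta> S"
  show "\<exists>K. \<forall>u\<in>?X. L2w_norm \<Omega> \<rho> (trace u) \<le> K * H_norm \<Omega> \<delta> u"
  proof (intro exI ballI)
    fix u assume u: "u \<in> ?X"
    have "weakly_diff u" "Hsq u < \<infinity>" using u by (auto simp: H_closure_iff[OF S])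
    then show "L2w_norm \<Omega> \<rho> (trace u) \<le> 8 * H_norm \<Omega> \<delta> u"
      using is_trace_bound[OF _ is_trace_trace[OF S u]] unfolding L2w_norm_def H_norm_def
      by (intro norm_le_if_norm_sq_le) auto
  qed
  fix u assume u: "u \<in> ?X \<inter> S"
  then have "weakly_diff u" "is_trace u (trace u)" "is_trace u (base_values u)"
    using is_trace_trace[OF S] is_trace_smooth S by (auto simp: H_closure_iff[OF S])
  then show "AE x in lebesgue_on \<Omega>. trace u x = u (x, 0)"
    by (intro is_trace_unique[of u _ u]) auto
qed

section \<open>Comparison of the two weights on the base\<close>

lemma L2w_norm_sq_rho:
  assumes "g \<in> borel_measurable (lebesgue_on \<Omega>)"
  shows "Lsq g = 4 * L2w_norm_sq \<Omega> (\<lambda>x. (s x)\<^sup>2) g"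
proof -
  note [measurable] = assms s_measurable
  have "Lsq g = (\<integral>\<^sup>+x. 4 * ennreal (\<bar>g x\<bar>\<^sup>2 * (s x)\<^sup>2) \<partial>lebesgue_on \<Omega>)"
    unfolding L2w_norm_sq_def
    by (intro nn_integral_cong) (simp add: ennreal_mult'[symmetric] power2_eq_square algebra_simps flip: ennreal_numeral)
  also have "\<dots> = 4 * L2w_norm_sq \<Omega> (\<lambda>x. (s x)\<^sup>2) g"
    unfolding L2w_norm_sq_def by (rule nn_integral_cmult) measurable
  finally show ?thesis .
qed

lemma L2w_space_rho: "L2w_space \<Omega> \<rho> = L2w_space \<Omega> (\<lambda>x. (s x)\<^sup>2)"
proof -
  have "Lsq g < \<infinity> \<longleftrightarrow> L2w_norm_sq \<Omega> (\<lambda>x. (s x)\<^sup>2) g < \<infinity>"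
    if "g \<in> borel_measurable (lebesgue_on \<Omega>)" for g
    unfolding L2w_norm_sq_rho[OF that] by (auto simp: ennreal_mult_less_top)
  then show ?thesis unfolding L2w_space_def by blast
qed

lemma L2w_norm_rho:
  "g \<in> borel_measurable (lebesgue_on \<Omega>) \<Longrightarrow> L2w_norm \<Omega> \<rho> g = 2 * L2w_norm \<Omega> (\<lambda>x. (s x)\<^sup>2) g"
  by (simp only: L2w_norm_def L2w_norm_sq_rho enn2real_mult real_sqrt_mult) simp

end

theorem theorem2p3:
  fixes \<Omega> :: "'a::euclidean_space set"
    and s \<delta> :: "'a \<Rightarrow> real"
    and X S :: "('a \<times> real \<Rightarrow> real) set"
  assumes "\<Omega> \<noteq> {}" and "open \<Omega>" and "connected \<Omega>" and "bounded \<Omega>"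
    and "lipschitz_boundary \<Omega>"
    and "s \<in> borel_measurable (lebesgue_on \<Omega>)"
    and "AE x in lebesgue_on \<Omega>. 0 \<le> s x \<and> s x \<le> 1"
    and "\<delta> = (\<lambda>x. 1 - 2 * s x)"
    and "{x \<in> \<Omega>. s x = 0} \<in> null_sets lebesgue"
    and "(X = H_space \<Omega> \<delta> \<and> S = smooth_cylinder \<Omega>) \<or>
         (X = H0_space \<Omega> \<delta> \<and> S = smooth_cylinder_c \<Omega>)"
  shows "(\<exists>T. trace_operator \<Omega> \<delta> X S (\<lambda>x. (1 - \<delta> x)\<^sup>2) T \<and>
              (\<forall>T'. trace_operator \<Omega> \<delta> X S (\<lambda>x. (1 - \<delta> x)\<^sup>2) T' \<longrightarrow>
                 (\<forall>u\<in>X. AE x in lebesgue_on \<Omega>. T' u x = T u x)))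
       \<and> L2w_space \<Omega> (\<lambda>x. (1 - \<delta> x)\<^sup>2) = L2w_space \<Omega> (\<lambda>x. (s x)\<^sup>2)
       \<and> (\<exists>c>0. \<exists>C>0. \<forall>g \<in> L2w_space \<Omega> (\<lambda>x. (s x)\<^sup>2).
            c * L2w_norm \<Omega> (\<lambda>x. (s x)\<^sup>2) g \<le> L2w_norm \<Omega> (\<lambda>x. (1 - \<delta> x)\<^sup>2) g \<and>
            L2w_norm \<Omega> (\<lambda>x. (1 - \<delta> x)\<^sup>2) g \<le> C * L2w_norm \<Omega> (\<lambda>x. (s x)\<^sup>2) g)"
proof -
  interpret degenerate_cylinder \<Omega> s
    using assms(2,6,7,9) by unfold_locales
  have \<delta>: "\<delta> = (\<lambda>x. 1 - 2 * s x)" by (rule assms(8))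
  \<comment> \<open>From here on the two cases are treated alike: in both, \<open>X\<close> is the
    closure of a set of smooth functions stable under sums and multiples.\<close>
  have S: "S \<subseteq> smooth_cylinder \<Omega>" and X: "X = H_closure \<Omega> \<delta> S"
    and add: "\<And>p q. p \<in> S \<Longrightarrow> q \<in> S \<Longrightarrow> (\<lambda>z. p z + q z) \<in> S"
    and mult: "\<And>p c. p \<in> S \<Longrightarrow> (\<lambda>z. c * p z) \<in> S"
    using assms(10) smooth_cylinder_c_subset[of \<Omega>]
    by (auto simp: H_space_def H0_space_def
        intro: smooth_cylinder_add smooth_cylinder_mult smooth_cylinder_c_add smooth_cylinder_c_mult)
  have T: "trace_operator \<Omega> \<delta> X S (\<lambda>x. (1 - \<delta> x)\<^sup>2) trace"
    unfolding X \<delta> using S add mult by (rule trace_operator_trace)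
  have unique: "AE x in lebesgue_on \<Omega>. T' u x = trace u x"
    if T': "trace_operator \<Omega> \<delta> X S (\<lambda>x. (1 - \<delta> x)\<^sup>2) T'" and u: "u \<in> X" for T' u
  proof -
    have "is_trace u (T' u)"
      by (rule is_trace_trace_operator[OF S add mult T'[unfolded X \<delta>] u[unfolded X \<delta>]])
    moreover have "is_trace u (trace u)" "\<exists>g. has_weak_gradient (cylinder \<Omega>) u g"
      using is_trace_trace[OF S u[unfolded X \<delta>]] u[unfolded X \<delta>] by (auto simp: H_closure_iff[OF S])
    ultimately show ?thesis by (intro is_trace_unique[of u _ u]) auto
  qed
  have norms: "L2w_norm \<Omega> (\<lambda>x. (1 - \<delta> x)\<^sup>2) g = 2 * L2w_norm \<Omega> (\<lambda>x. (s x)\<^sup>2) g"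
    if "g \<in> L2w_space \<Omega> (\<lambda>x. (s x)\<^sup>2)" for g
    using that unfolding \<delta> L2w_space_def by (intro L2w_norm_rho) simp
  show ?thesis
  proof (intro conjI)
    show "\<exists>T. trace_operator \<Omega> \<delta> X S (\<lambda>x. (1 - \<delta> x)\<^sup>2) T \<and>
        (\<forall>T'. trace_operator \<Omega> \<delta> X S (\<lambda>x. (1 - \<delta> x)\<^sup>2) T' \<longrightarrow>
          (\<forall>u\<in>X. AE x in lebesgue_on \<Omega>. T' u x = T u x))"
      using T unique by blast
    show "L2w_space \<Omega> (\<lambda>x. (1 - \<delta> x)\<^sup>2) = L2w_space \<Omega> (\<lambda>x. (s x)\<^sup>2)"
      unfolding \<delta> by (rule L2w_space_rho)
    \<comment> \<open>The norms are proportional, the factor 2 being the root of 4, so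
      \<open>c = C = 2\<close>.\<close>
    show "\<exists>c>0. \<exists>C>0. \<forall>g \<in> L2w_space \<Omega> (\<lambda>x. (s x)\<^sup>2).
        c * L2w_norm \<Omega> (\<lambda>x. (s x)\<^sup>2) g \<le> L2w_norm \<Omega> (\<lambda>x. (1 - \<delta> x)\<^sup>2) g \<and>
        L2w_norm \<Omega> (\<lambda>x. (1 - \<delta> x)\<^sup>2) g \<le> C * L2w_norm \<Omega> (\<lambda>x. (s x)\<^sup>2) g"
      using norms by (intro exI[of _ "2::real"] conjI ballI) simp_all
  qed
qed

end
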